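(* Let $(A,\mathfrak{m})$ be a Noetherian local ring and let $G=\bigoplus_{n\ge 0}\mathfrak{m}^n/\mathfrak{m}^{n+1}$ be the associated graded ring of $\mathfrak{m}$. If $\operatorname{depth} G\ge 2$, then $\mathfrak{m}^{\ell}$ has the strong Rees property for every integer $\ell\ge 1$.
   Context: For an ideal $I$ of $A$, $\mu(I)=\ell_A(I/\mathfrak{m}I)$ denotes the minimal number of generators. An $\mathfrak{m}$-primary ideal $I$ has the strong Rees property if $\mu(J)<\mu(I)$ for every ideal $J$ of $A$ with $J\supsetneq I$. The depth of $G$ is its depth with respect to its homogeneous maximal ideal $\bigoplus_{n\ge 1}\mathfrak{m}^n/\mathfrak{m}^{n+1}$. *)

theory Defs
  imports "HOL-Algebra.Algebra" "HOL-Library.Extended_Nat"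
begin

locale noetherian_local_ring = cring R + noetherian_ring R + maximalideal \<mm> R
  for R (structure) and \<mm> +
  assumes maximalideal_unique: "maximalideal J R \<Longrightarrow> J = \<mm>"

text \<open>Powers in the monoid of ideals under \<^const>\<open>ideal_prod\<close>; the power with exponent 0 is
  \<^term>\<open>carrier R\<close>.\<close>

abbreviation ideal_pow :: "('a, 'b) ring_scheme \<Rightarrow> 'a set \<Rightarrow> nat \<Rightarrow> 'a set"
  where "ideal_pow R I n \<equiv> I [^]\<^bsub>ideals_set R\<^esub> n"


section \<open>The associated graded ring\<close>

definition graded_piece :: "('a, 'b) ring_scheme \<Rightarrow> 'a set \<Rightarrow> nat \<Rightarrow> 'a set set"
  where "graded_piece R I n = (\<lambda>x. ideal_pow R I (Suc n) +>\<^bsub>R\<^esub> x) ` ideal_pow R I n"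

text \<open>An element of the direct sum is the finitely supported sequence of its homogeneous
  components; the component in degree \<open>n\<close> is a coset of \<open>I ^ (n + 1)\<close>, so the zero component is
  \<open>I ^ (n + 1)\<close> itself. For \<open>x \<in> I ^ i\<close> and \<open>y \<in> I ^ j\<close> the product of \<open>x + I ^ (i + 1)\<close> and
  \<open>y + I ^ (j + 1)\<close> is \<open>x y + I ^ (i + j + 1)\<close>, which is their \<^const>\<open>rcoset_mult\<close> modulo
  \<open>I ^ (i + j + 1)\<close> (lemma \<open>rcoset_mult_graded_piece\<close> below). The degree \<open>n\<close> piece is contained in
  \<open>R / I ^ (n + 1)\<close>, so the sum over \<open>i + j = n\<close> may be taken in that ring.\<close>

definition assoc_graded :: "('a, 'b) ring_scheme \<Rightarrow> 'a set \<Rightarrow> (nat \<Rightarrow> 'a set) ring"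
  where "assoc_graded R I =
    \<lparr>carrier = {f. (\<forall>n. f n \<in> graded_piece R I n) \<and> finite {n. f n \<noteq> ideal_pow R I (Suc n)}},
     monoid.mult = (\<lambda>f g n. \<Oplus>\<^bsub>R Quot ideal_pow R I (Suc n)\<^esub> i \<in> {..n}.
               rcoset_mult R (ideal_pow R I (Suc n)) (f i) (g (n - i))),
     one = (\<lambda>n. if n = 0 then ideal_pow R I 1 +>\<^bsub>R\<^esub> \<one>\<^bsub>R\<^esub> else ideal_pow R I (Suc n)),
     ring.zero = (\<lambda>n. ideal_pow R I (Suc n)),
     ring.add = (\<lambda>f g n. f n <+>\<^bsub>R\<^esub> g n)\<rparr>"

text \<open>The ideal of elements of positive degree. If \<open>I\<close> is maximal, this is the homogeneous maximal
  ideal.\<close>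

definition irrelevant_ideal :: "('a, 'b) ring_scheme \<Rightarrow> 'a set \<Rightarrow> (nat \<Rightarrow> 'a set) set"
  where "irrelevant_ideal R I =
    {f \<in> carrier (assoc_graded R I). f 0 = \<zero>\<^bsub>assoc_graded R I\<^esub> 0}"

lemma (in cring) rcoset_mult_graded_piece:
  assumes I: "ideal I R" and x: "x \<in> ideal_pow R I i" and y: "y \<in> ideal_pow R I j"
  shows "rcoset_mult R (ideal_pow R I (Suc (i + j)))
           (ideal_pow R I (Suc i) +> x) (ideal_pow R I (Suc j) +> y)
         = ideal_pow R I (Suc (i + j)) +> (x \<otimes> y)"
proof -
  interpret S: comm_monoid "ideals_set R"
    by (rule ideals_set_is_comm_monoid)
  have IS: "I \<in> carrier (ideals_set R)"
    using I by (simp add: ideals_set_def)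
  have idl: "ideal (ideal_pow R I n) R" for n
    using S.nat_pow_closed[OF IS, of n] by (simp add: ideals_set_def)
  have prod: "a \<otimes> b \<in> ideal_pow R I (p + q)"
    if "a \<in> ideal_pow R I p" "b \<in> ideal_pow R I q" for a b p q
    using ideal_prod.prod[OF that, of R] S.nat_pow_mult[OF IS, of p q]
    by (simp add: ideals_set_def)
  interpret K: ideal "ideal_pow R I (Suc (i + j))" R by (rule idl)
  interpret Ki: ideal "ideal_pow R I (Suc i)" R by (rule idl)
  interpret Kj: ideal "ideal_pow R I (Suc j)" R by (rule idl)
  have xc: "x \<in> carrier R" and yc: "y \<in> carrier R"
    using ideal.Icarr[OF idl] x y by blast+
  have eq: "ideal_pow R I (Suc (i + j)) +> (a \<otimes> b) = ideal_pow R I (Suc (i + j)) +> (x \<otimes> y)"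
    if a: "a \<in> ideal_pow R I (Suc i) +> x" and b: "b \<in> ideal_pow R I (Suc j) +> y" for a b
  proof -
    from a b obtain h k where h: "h \<in> ideal_pow R I (Suc i)" "a = h \<oplus> x"
      and k: "k \<in> ideal_pow R I (Suc j)" "b = k \<oplus> y"
      by (auto simp: a_r_coset_def')
    have hc: "h \<in> carrier R" and kc: "k \<in> carrier R"
      using h(1) k(1) Ki.Icarr Kj.Icarr by blast+
    have "h \<in> ideal_pow R I i"
      using h(1) ideal_prod_inter[OF idl I, of i] by (auto simp: ideals_set_def)
    then have "h \<otimes> k \<in> ideal_pow R I (Suc (i + j))"
      using prod[of h i k "Suc j"] k(1) by simp
    moreover have "h \<otimes> y \<in> ideal_pow R I (Suc (i + j))"
      using prod[of h "Suc i" y j] h(1) y by simp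
    moreover have "x \<otimes> k \<in> ideal_pow R I (Suc (i + j))"
      using prod[of x i k "Suc j"] k(1) x by simp
    ultimately have m: "h \<otimes> k \<oplus> h \<otimes> y \<oplus> x \<otimes> k \<in> ideal_pow R I (Suc (i + j))"
      by (meson K.a_closed)
    have "a \<otimes> b = (h \<otimes> k \<oplus> h \<otimes> y \<oplus> x \<otimes> k) \<oplus> x \<otimes> y"
      using xc yc hc kc h(2) k(2) by algebra
    then have "a \<otimes> b \<in> ideal_pow R I (Suc (i + j)) +> (x \<otimes> y)"
      using m by (auto simp: a_r_coset_def')
    then show ?thesis
      using K.a_repr_independence' xc yc by (metis m_closed)
  qed
  have "x \<in> ideal_pow R I (Suc i) +> x" "y \<in> ideal_pow R I (Suc j) +> y"
    using Ki.a_rcos_self Kj.a_rcos_self xc yc by auto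
  then show ?thesis
    unfolding rcoset_mult_def using eq by blast
qed


section \<open>Depth\<close>

definition nonzerodivisor :: "('a, 'b) ring_scheme \<Rightarrow> 'a \<Rightarrow> bool"
  where "nonzerodivisor R x \<longleftrightarrow>
    x \<in> carrier R \<and> (\<forall>y \<in> carrier R. x \<otimes>\<^bsub>R\<^esub> y = \<zero>\<^bsub>R\<^esub> \<longrightarrow> y = \<zero>\<^bsub>R\<^esub>)"

definition regular_sequence :: "('a, 'b) ring_scheme \<Rightarrow> 'a list \<Rightarrow> bool"
  where "regular_sequence R xs \<longleftrightarrow>
    set xs \<subseteq> carrier R \<and>
    (\<forall>i < length xs. nonzerodivisor (R Quot (Idl\<^bsub>R\<^esub> (set (take i xs))))
                       (Idl\<^bsub>R\<^esub> (set (take i xs)) +>\<^bsub>R\<^esub> (xs ! i))) \<and>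
    Idl\<^bsub>R\<^esub> (set xs) \<noteq> carrier R"

definition depth :: "('a, 'b) ring_scheme \<Rightarrow> 'a set \<Rightarrow> enat"
  where "depth R I = Sup {enat (length xs) | xs. set xs \<subseteq> I \<and> regular_sequence R xs}"


section \<open>Length and number of generators\<close>

text \<open>The fields \<open>mult\<close> and \<open>one\<close>, which the record type \<open>module\<close> inherits from \<open>ring\<close>, carry
  no meaning for a module; \<^const>\<open>FactRing\<close>, applied to a module, supplies the additive
  structure of the quotient.\<close>

definition ideal_module :: "('a, 'b) ring_scheme \<Rightarrow> 'a set \<Rightarrow> ('a, 'a) module"
  where "ideal_module R I =
    \<lparr>carrier = I, monoid.mult = (\<otimes>\<^bsub>R\<^esub>), one = \<one>\<^bsub>R\<^esub>,
     ring.zero = \<zero>\<^bsub>R\<^esub>, ring.add = (\<oplus>\<^bsub>R\<^esub>), smult = (\<otimes>\<^bsub>R\<^esub>)\<rparr>"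

definition quotient_module ::
    "('r, 'a, 'b) module_scheme \<Rightarrow> 'a set \<Rightarrow> ('r, 'a set) module"
  where "quotient_module M N =
    ring.extend (M Quot N) (module.fields (\<lambda>a C. \<Union>x \<in> C. N +>\<^bsub>M\<^esub> (a \<odot>\<^bsub>M\<^esub> x)))"

definition module_length ::
    "('r, 'b) ring_scheme \<Rightarrow> ('r, 'a, 'c) module_scheme \<Rightarrow> enat"
  where "module_length R M =
    Sup {enat n | n. \<exists>N. (\<forall>i \<le> n. submodule (N i) R M) \<and> (\<forall>i < n. N i \<subset> N (Suc i))}"

definition num_gens :: "('a, 'b) ring_scheme \<Rightarrow> 'a set \<Rightarrow> 'a set \<Rightarrow> enat"
  where "num_gens R \<mm> I =
    module_length R (quotient_module (ideal_module R I) (ideal_prod R \<mm> I))"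


section \<open>The strong Rees property\<close>

definition primary_ideal :: "('a, 'b) ring_scheme \<Rightarrow> 'a set \<Rightarrow> bool"
  where "primary_ideal R Q \<longleftrightarrow>
    ideal Q R \<and> Q \<noteq> carrier R \<and>
    (\<forall>a \<in> carrier R. \<forall>b \<in> carrier R.
       a \<otimes>\<^bsub>R\<^esub> b \<in> Q \<longrightarrow> a \<in> Q \<or> (\<exists>n::nat. b [^]\<^bsub>R\<^esub> n \<in> Q))"

definition radical :: "('a, 'b) ring_scheme \<Rightarrow> 'a set \<Rightarrow> 'a set"
  where "radical R I = {x \<in> carrier R. \<exists>n::nat. x [^]\<^bsub>R\<^esub> n \<in> I}"

definition strong_Rees :: "('a, 'b) ring_scheme \<Rightarrow> 'a set \<Rightarrow> 'a set \<Rightarrow> bool"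
  where "strong_Rees R \<mm> I \<longleftrightarrow>
    primary_ideal R I \<and> radical R I = \<mm> \<and>
    (\<forall>J. ideal J R \<and> I \<subset> J \<longrightarrow> num_gens R \<mm> J < num_gens R \<mm> I)"

end

theory Submission
  imports Defs
begin

text \<open>An ideal \<open>B\<close> with \<open>\<mm>\<^sup>i\<^sup>+\<^sup>1 \<subseteq> B \<subseteq> \<mm>\<^sup>i\<close> is the same thing as a subspace \<open>V\<close> of the component
  \<open>G\<^sub>i\<close> of the associated graded ring \<open>G\<close>, over the residue field \<open>k\<close>, and the ideal \<open>\<mm> B\<close>
  corresponds to \<open>G\<^sub>1 V\<close>. Let \<open>J\<close> be an ideal strictly containing \<open>\<mm>\<^sup>l\<close>, and let \<open>V\<^sub>i \<subseteq> G\<^sub>i\<close> be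
  its space of initial forms of degree \<open>i\<close>. Counting lengths along the filtration of \<open>J\<close> by the
  ideals \<open>J \<inter> \<mm>\<^sup>i\<close> shows that the number of generators of \<open>\<mm>\<^sup>l\<close> exceeds that of \<open>J\<close> by at least
  the sum over \<open>i < l\<close> of \<open>dim G\<^sub>1 V\<^sub>i - dim V\<^sub>i\<close> (\<open>colength_increment\<close>). So the theorem follows
  from the inequality \<open>dim V < dim G\<^sub>1 V\<close> for every nonzero subspace \<open>V\<close> of every \<open>G\<^sub>i\<close>
  (\<open>layer_dim_increases\<close>).

  Over an infinite field that inequality could be obtained from a regular sequence of linear
  forms; over a finite field there need not be one, and the following argument does without it.
  Assume \<open>dim G\<^sub>1 V \<le> dim V\<close> for some \<open>V \<noteq> 0\<close>, and choose \<open>V\<close> in its degree to maximise \<open>dim V -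
  dim G\<^sub>1 V\<close>. As in Petridis's proof of Pluennecke's inequality, the maximality is inherited by
  products and gives \<open>dim G\<^sub>n\<^sub>+\<^sub>1 V \<le> dim G\<^sub>n V\<close> for all \<open>n\<close> (\<open>power_dim_antimono\<close>), so that the
  Hilbert function of the submodule \<open>G V\<close> is bounded. That is impossible (\<open>no_bounded_layer\<close>):
  take a nonzero \<open>V\<close> for which the bound is as small as possible. Every nonzero homogeneous
  submodule of \<open>G V\<close> then coincides with \<open>G V\<close> in some degree, hence in all larger ones, so a
  linear form that kills one nonzero homogeneous element of \<open>G V\<close> kills \<open>V\<close>
  (\<open>annihilator_of_minimal\<close>). As \<open>G\<close> has positive depth, some linear form \<open>h\<close> does not kill \<open>V\<close>;
  it is injective on \<open>G V\<close>, and by boundedness \<open>G\<^sub>n\<^sub>+\<^sub>1 V = h G\<^sub>n V\<close> for large \<open>n\<close>. Depth two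
  makes this divisibility by \<open>h\<close> descend to all degrees once \<open>G V\<close> is replaced by its saturation
  (\<open>saturation_divisible\<close>). Dividing a homogeneous element of the saturation by \<open>h\<close> until the
  degree becomes negative shows that it is zero.

  The depth of \<open>G\<close> is used only through the vanishing of \<open>Hom(k, G)\<close> and of the part of
  \<open>Ext\<^sup>1(k, G)\<close> given by homogeneous maps \<open>G\<^sub>1 \<rightarrow> G\<^sub>n\<close>. Both are expressed by elements of the
  local ring in the locale \<open>local_ring_depth_two\<close>, and \<open>local_ring_depth_two_if_depth_ge_2\<close>
  derives them from a regular sequence, which may be inhomogeneous.\<close>

no_notation Sum_Type.Plus (infixr \<open><+>\<close> 65)

section \<open>Lengths of intervals of ideals\<close>

inductive ideal_chain :: "('a, 'b) ring_scheme \<Rightarrow> 'a set \<Rightarrow> 'a set \<Rightarrow> nat \<Rightarrow> bool" for R where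
  refl: "ideal L R \<Longrightarrow> ideal_chain R L L 0"
| step: "ideal_chain R L K n \<Longrightarrow> ideal N R \<Longrightarrow> K \<subset> N \<Longrightarrow> ideal_chain R L N (Suc n)"

definition ideal_length :: "('a, 'b) ring_scheme \<Rightarrow> 'a set \<Rightarrow> 'a set \<Rightarrow> enat" where
  "ideal_length R L N = Sup {enat n | n. ideal_chain R L N n}"

lemma ideal_chain_ideals:
  "ideal_chain R L N n \<Longrightarrow> ideal L R \<and> ideal N R \<and> L \<subseteq> N"
  by (induction rule: ideal_chain.induct) auto

lemma ideal_chain_trans:
  "ideal_chain R M N q \<Longrightarrow> ideal_chain R L M p \<Longrightarrow> ideal_chain R L N (p + q)"
  by (induction rule: ideal_chain.induct) (auto intro: ideal_chain.intros)

lemma ideal_chain_widen: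
  assumes "ideal_chain R L N n" "ideal M R" "N \<subseteq> M"
  shows "\<exists>p \<ge> n. ideal_chain R L M p"
  using assms by (metis ideal_chain.step le_SucI order_refl psubsetI)

lemma ideal_chain_map:
  assumes "ideal_chain R L N n"
    and "\<And>K. ideal K R \<Longrightarrow> L \<subseteq> K \<Longrightarrow> K \<subseteq> N \<Longrightarrow> ideal (F K) S"
    and "\<And>K K'. ideal K R \<Longrightarrow> ideal K' R \<Longrightarrow> L \<subseteq> K \<Longrightarrow> K \<subset> K' \<Longrightarrow> K' \<subseteq> N \<Longrightarrow> F K \<subset> F K'"
  shows "ideal_chain S (F L) (F N) n"
  using assms
proof (induction rule: ideal_chain.induct)
  case (refl L)
  then show ?case by (simp add: ideal_chain.refl)
next
  case (step L K n N)
  have K: "ideal K R" "L \<subseteq> K" "ideal L R"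
    using ideal_chain_ideals[OF step.hyps(1)] by auto
  have "ideal_chain S (F L) (F K) n"
  proof (rule step.IH)
    fix K1 assume "ideal K1 R" "L \<subseteq> K1" "K1 \<subseteq> K"
    with step.hyps(3) show "ideal (F K1) S"
      by (intro step.prems(1)) blast+
  next
    fix K1 K2 assume "ideal K1 R" "ideal K2 R" "L \<subseteq> K1" "K1 \<subset> K2" "K2 \<subseteq> K"
    with step.hyps(3) show "F K1 \<subset> F K2"
      by (intro step.prems(2)) blast+
  qed
  moreover have "ideal (F N) S" "F K \<subset> F N"
    using step.hyps K by (intro step.prems; blast)+
  ultimately show ?case by (rule ideal_chain.step)
qed

lemma enat_le_Sup_iff:
  assumes "S \<noteq> {}"
  shows "enat k \<le> Sup (enat ` S) \<longleftrightarrow> (\<exists>n \<in> S. k \<le> n)"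
proof
  assume le: "enat k \<le> Sup (enat ` S)"
  show "\<exists>n \<in> S. k \<le> n"
  proof (rule ccontr)
    assume neg: "\<not> ?thesis"
    then have lt: "\<And>n. n \<in> S \<Longrightarrow> n < k" by (meson linorder_not_le)
    then have k: "k > 0" using assms by fastforce
    have "Sup (enat ` S) \<le> enat (k - 1)"
      by (rule Sup_least) (use lt in fastforce)
    then have "enat k \<le> enat (k - 1)" using le order_trans by blast
    then show False using k by simp
  qed
next
  assume "\<exists>n \<in> S. k \<le> n"
  then show "enat k \<le> Sup (enat ` S)"
  proof
    fix n assume n: "n \<in> S" "k \<le> n"
    have "enat k \<le> enat n" using n by simp
    also have "\<dots> \<le> Sup (enat ` S)" using n by (intro Sup_upper) auto
    finally show ?thesis .
  qed
qed

lemma enat_eqI: "(\<And>k. enat k \<le> a \<longleftrightarrow> enat k \<le> b) \<Longrightarrow> a = b"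
  (is "(\<And>k. ?A k) \<Longrightarrow> _")
proof (rule order_antisym)
  have *: "c \<le> d" if "\<And>k. enat k \<le> c \<Longrightarrow> enat k \<le> d" for c d :: enat
  proof (cases d)
    case (enat n)
    then have "\<not> enat (Suc n) \<le> c" using that[of "Suc n"] by auto
    then show ?thesis using enat by (cases c) auto
  qed auto
  assume eq: "\<And>k. ?A k"
  show "a \<le> b" by (rule *) (simp add: eq)
  show "b \<le> a" by (rule *) (simp add: eq)
qed

lemma enat_le_add_iff:
  "enat k \<le> a + b \<longleftrightarrow> (\<exists>p q. k \<le> p + q \<and> enat p \<le> a \<and> enat q \<le> b)"
proof
  assume "enat k \<le> a + b"
  then show "\<exists>p q. k \<le> p + q \<and> enat p \<le> a \<and> enat q \<le> b"
  proof -
    consider m n where "a = enat m" "b = enat n" | "a = \<infinity>" | "b = \<infinity>"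
      by (cases a; cases b) auto
    then show ?thesis
    proof cases
    fix m n assume "a = enat m" "b = enat n"
    then show ?thesis using \<open>enat k \<le> a + b\<close> by (intro exI[of _ m] exI[of _ n]) auto
  next
    assume "a = \<infinity>"
    then show ?thesis by (intro exI[of _ k] exI[of _ 0]) (auto simp: zero_enat_def[symmetric])
  next
    assume "b = \<infinity>"
    then show ?thesis by (intro exI[of _ 0] exI[of _ k]) (auto simp: zero_enat_def[symmetric])
    qed
  qed
next
  assume "\<exists>p q. k \<le> p + q \<and> enat p \<le> a \<and> enat q \<le> b"
  then show "enat k \<le> a + b"
  proof (elim exE conjE)
    fix p q assume pq: "k \<le> p + q" "enat p \<le> a" "enat q \<le> b"
    have "enat k \<le> enat p + enat q" using pq by simp
    also have "\<dots> \<le> a + b" using pq by (intro add_mono)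
    finally show ?thesis .
  qed
qed

context ring
begin

lemma ideal_sum_mem: "a \<in> I \<Longrightarrow> b \<in> J \<Longrightarrow> a \<oplus> b \<in> I <+> J"
  by (auto simp: set_add_def')

lemma ideal_sum_upper:
  assumes "ideal I R" "ideal J R"
  shows "I \<subseteq> I <+> J" "J \<subseteq> I <+> J"
proof -
  interpret I: ideal I R by fact
  interpret J: ideal J R by fact
  show "I \<subseteq> I <+> J"
  proof
    fix a assume "a \<in> I"
    then show "a \<in> I <+> J" using ideal_sum_mem[of a I \<zero> J] by simp
  qed
  show "J \<subseteq> I <+> J"
  proof
    fix a assume "a \<in> J"
    then show "a \<in> I <+> J" using ideal_sum_mem[of \<zero> I a J] by simp
  qed
qed

lemma ideal_sum_least:
  assumes "ideal K R" "I \<subseteq> K" "J \<subseteq> K"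
  shows "I <+> J \<subseteq> K"
proof -
  interpret ideal K R by fact
  show ?thesis using assms by (auto simp: set_add_def')
qed

lemma ideal_minus:
  assumes "ideal I R" "a \<in> I" "b \<in> I"
  shows "a \<ominus> b \<in> I"
proof -
  interpret ideal I R by fact
  show ?thesis using assms by (simp add: a_minus_def)
qed

lemma ideal_minus_cancel:
  assumes "ideal I R" "a \<ominus> b \<in> I" "b \<in> I" "a \<in> carrier R"
  shows "a \<in> I"
proof -
  have "b \<in> carrier R" using ideal.Icarr[OF assms(1,3)] .
  then have "(a \<ominus> b) \<oplus> b = a" using assms(4) by (simp add: a_minus_def a_assoc l_neg)
  then show ?thesis
    using additive_subgroup.a_closed[OF ideal.axioms(1)[OF assms(1)] assms(2,3)] by simp
qed

lemma ideal_subset_carrier: "ideal I R \<Longrightarrow> I \<subseteq> carrier R"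
  using ideal.Icarr[of I R] by auto

lemma ideal_prod_mono:
  assumes "B \<subseteq> C" shows "ideal_prod R I B \<subseteq> ideal_prod R I C"
proof
  fix x assume "x \<in> ideal_prod R I B"
  then show "x \<in> ideal_prod R I C"
    by (induction rule: ideal_prod.induct) (use assms in \<open>auto intro: ideal_prod.intros\<close>)
qed

lemma ideal_prod_least:
  assumes "ideal K R" "\<And>a b. a \<in> I \<Longrightarrow> b \<in> B \<Longrightarrow> a \<otimes> b \<in> K"
  shows "ideal_prod R I B \<subseteq> K"
proof
  interpret K: ideal K R by fact
  fix x assume "x \<in> ideal_prod R I B"
  then show "x \<in> K"
    by (induction rule: ideal_prod.induct) (simp_all add: assms(2))
qed

lemma exists_ideal_chain:
  assumes "ideal L R" "ideal N R" "L \<subseteq> N"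
  shows "\<exists>n. ideal_chain R L N n"
  using assms by (metis ideal_chain_widen ideal_chain.refl)

lemma enat_le_ideal_length_iff:
  assumes "ideal L R" "ideal N R" "L \<subseteq> N"
  shows "enat k \<le> ideal_length R L N \<longleftrightarrow> (\<exists>n \<ge> k. ideal_chain R L N n)"
proof -
  have "{enat n | n. ideal_chain R L N n} = enat ` {n. ideal_chain R L N n}" by auto
  then show ?thesis
    unfolding ideal_length_def
    using enat_le_Sup_iff[of "{n. ideal_chain R L N n}" k] exists_ideal_chain[OF assms] by auto
qed

text \<open>Each step of a chain is strict after intersecting with \<open>M\<close> or after adding \<open>M\<close>, by the
  modular law; this is what makes lengths additive.\<close>

lemma ideal_chain_split:
  assumes "ideal_chain R L N n" "ideal M R" "L \<subseteq> M"
  shows "\<exists>p q. n \<le> p + q \<and> ideal_chain R L (N \<inter> M) p \<and> ideal_chain R M (N <+> M) q"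
  using assms
proof (induction rule: ideal_chain.induct)
  case (refl L)
  have "L <+> M = M"
    using refl ideal_sum_upper[of L M] ideal_sum_least[of M L M] by auto
  then show ?case
    using refl by (auto simp: Int_absorb2 intro!: exI[of _ 0] ideal_chain.refl)
next
  case (step L K n N)
  obtain p q where pq: "n \<le> p + q" "ideal_chain R L (K \<inter> M) p" "ideal_chain R M (K <+> M) q"
    using step.IH step.prems by blast
  have K: "ideal K R" using ideal_chain_ideals[OF step.hyps(1)] by auto
  have i1: "ideal (N \<inter> M) R" and i2: "ideal (N <+> M) R"
    using i_intersect step add_ideals by auto
  have s1: "K \<inter> M \<subseteq> N \<inter> M" using step by auto
  have s2: "K <+> M \<subseteq> N <+> M" using step by (auto simp: set_add_def')
  show ?case
  proof (cases "K \<inter> M = N \<inter> M")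
    case False
    then have "ideal_chain R L (N \<inter> M) (Suc p)"
      using pq(2) i1 s1 by (auto intro: ideal_chain.step)
    moreover obtain q' where "q' \<ge> q" "ideal_chain R M (N <+> M) q'"
      using ideal_chain_widen[OF pq(3) i2 s2] by blast
    ultimately show ?thesis using pq(1) by (intro exI[of _ "Suc p"] exI[of _ q']) auto
  next
    case True
    have "K <+> M \<noteq> N <+> M"
    proof
      assume eq: "K <+> M = N <+> M"
      have "N \<subseteq> K"
      proof
        fix x assume x: "x \<in> N"
        then have "x \<in> K <+> M" using eq ideal_sum_upper[of N M] step by auto
        then obtain a b where ab: "a \<in> K" "b \<in> M" "x = a \<oplus> b" by (auto simp: set_add_def')
        have c: "a \<in> carrier R" "b \<in> carrier R"
          using ideal.Icarr[OF K ab(1)] ideal.Icarr[OF step.prems(1) ab(2)] by auto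
        have "x \<ominus> a = b" unfolding ab(3) using c
          by (simp add: a_minus_def a_comm[of a b] a_assoc r_neg)
        moreover have "x \<ominus> a \<in> N"
          using ideal_minus[OF step.hyps(2)] x ab step.hyps(3) by blast
        ultimately have "b \<in> N" by simp
        then have "b \<in> K" using ab True by auto
        then show "x \<in> K"
          using ab additive_subgroup.a_closed[OF ideal.axioms(1)[OF K]] by simp
      qed
      then show False using step.hyps(3) by auto
    qed
    then have "ideal_chain R M (N <+> M) (Suc q)"
      using pq(3) i2 s2 by (auto intro: ideal_chain.step)
    then show ?thesis using pq(1,2) True by (intro exI[of _ p] exI[of _ "Suc q"]) auto
  qed
qed

lemma ideal_length_add:
  assumes "ideal L R" "ideal M R" "ideal N R" "L \<subseteq> M" "M \<subseteq> N"
  shows "ideal_length R L N = ideal_length R L M + ideal_length R M N"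
proof (rule enat_eqI)
  fix k
  have LN: "L \<subseteq> N" using assms by auto
  have abs: "N \<inter> M = M" "N <+> M = N"
    using assms ideal_sum_upper[of N M] ideal_sum_least[of N N M] by auto
  show "enat k \<le> ideal_length R L N \<longleftrightarrow> enat k \<le> ideal_length R L M + ideal_length R M N"
  proof
    assume "enat k \<le> ideal_length R L N"
    then obtain n where n: "n \<ge> k" "ideal_chain R L N n"
      using enat_le_ideal_length_iff assms LN by blast
    then obtain p q where "n \<le> p + q" "ideal_chain R L M p" "ideal_chain R M N q"
      using ideal_chain_split[OF n(2), of M] assms abs by auto
    then show "enat k \<le> ideal_length R L M + ideal_length R M N"
      unfolding enat_le_add_iff
      using enat_le_ideal_length_iff[OF assms(1,2,4), of p]
        enat_le_ideal_length_iff[OF assms(2,3,5), of q] n(1)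
      by (intro exI[of _ p] exI[of _ q]) auto
  next
    assume "enat k \<le> ideal_length R L M + ideal_length R M N"
    then obtain p q where pq: "k \<le> p + q" "enat p \<le> ideal_length R L M" "enat q \<le> ideal_length R M N"
      unfolding enat_le_add_iff by blast
    then obtain p' q' where "p' \<ge> p" "q' \<ge> q" "ideal_chain R L M p'" "ideal_chain R M N q'"
      using enat_le_ideal_length_iff[OF assms(1,2,4), of p]
        enat_le_ideal_length_iff[OF assms(2,3,5), of q] by auto
    then have "ideal_chain R L N (p' + q')" "k \<le> p' + q'"
      using ideal_chain_trans pq(1) by auto
    then show "enat k \<le> ideal_length R L N"
      using enat_le_ideal_length_iff assms LN by blast
  qed
qed

lemma ideal_length_self:
  assumes "ideal L R"
  shows "ideal_length R L L = 0"
proof -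
  have "n = 0" if "ideal_chain R L L n" for n
    using that by (cases rule: ideal_chain.cases) (auto dest: ideal_chain_ideals)
  then have "{enat n | n. ideal_chain R L L n} \<subseteq> {0}" by (auto simp: zero_enat_def)
  then show ?thesis unfolding ideal_length_def
    by (intro antisym Sup_least) auto
qed

lemma ideal_length_pos:
  assumes "ideal L R" "ideal N R" "L \<subset> N"
  shows "ideal_length R L N \<ge> 1"
  using enat_le_ideal_length_iff[of L N 1] assms
    ideal_chain.step[OF ideal_chain.refl[OF assms(1)] assms(2,3)]
  by (auto simp: one_enat_def)

end

context cring
begin

lemma colon_ideal:
  assumes "ideal Z R" "ideal B R" "c \<in> carrier R"
  shows "ideal {x \<in> B. c \<otimes> x \<in> Z} R"
proof -
  interpret Z: ideal Z R by fact
  interpret B: ideal B R by fact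
  show ?thesis
  proof (rule idealI)
    show "ring R" by (rule ring_axioms)
    show "subgroup {x \<in> B. c \<otimes> x \<in> Z} (add_monoid R)"
    proof (rule add.subgroupI)
      show "{x \<in> B. c \<otimes> x \<in> Z} \<subseteq> carrier R" using B.Icarr by auto
      show "{x \<in> B. c \<otimes> x \<in> Z} \<noteq> {}"
        using B.zero_closed Z.zero_closed assms(3) by (metis (no_types, lifting) empty_iff mem_Collect_eq r_null)
    qed (use assms(3) B.Icarr in \<open>auto simp: r_distr r_minus a_inv_def[symmetric]\<close>)
  next
    fix a x assume "a \<in> {x \<in> B. c \<otimes> x \<in> Z}" "x \<in> carrier R"
    then have "x \<otimes> a \<in> {x \<in> B. c \<otimes> x \<in> Z}"
      using assms(3) B.Icarr Z.I_l_closed[of "c \<otimes> a" x] B.I_l_closed m_lcomm[of x c a] by auto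
    moreover have "x \<otimes> a = a \<otimes> x"
      using \<open>a \<in> _\<close> \<open>x \<in> _\<close> B.Icarr m_comm by auto
    ultimately show "x \<otimes> a \<in> {x \<in> B. c \<otimes> x \<in> Z}" "a \<otimes> x \<in> {x \<in> B. c \<otimes> x \<in> Z}" by auto
  qed
qed

lemma mult_image_ideal:
  assumes "ideal B R" "c \<in> carrier R"
  shows "ideal ((\<otimes>) c ` B) R"
proof -
  interpret B: ideal B R by fact
  show ?thesis
  proof (rule idealI)
    show "ring R" by (rule ring_axioms)
    show "subgroup ((\<otimes>) c ` B) (add_monoid R)"
    proof (rule add.subgroupI)
      show "(\<otimes>) c ` B \<subseteq> carrier R" using B.Icarr assms by auto
      show "(\<otimes>) c ` B \<noteq> {}" using B.zero_closed by blast
      fix a assume "a \<in> (\<otimes>) c ` B"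
      then show "\<ominus> a \<in> (\<otimes>) c ` B"
        using assms B.Icarr by (auto simp: r_minus[symmetric])
      fix b assume "b \<in> (\<otimes>) c ` B"
      then show "a \<oplus> b \<in> (\<otimes>) c ` B"
        using \<open>a \<in> _\<close> assms B.Icarr by (auto simp: r_distr[symmetric])
    qed
  next
    fix a x assume "a \<in> (\<otimes>) c ` B" and x: "x \<in> carrier R"
    then obtain y where y: "y \<in> B" "a = c \<otimes> y" by auto
    then have "x \<otimes> a = c \<otimes> (x \<otimes> y)" "a \<otimes> x = c \<otimes> (x \<otimes> y)"
      using x assms B.Icarr[of y] by algebra+
    then show "x \<otimes> a \<in> (\<otimes>) c ` B" "a \<otimes> x \<in> (\<otimes>) c ` B"
      using B.I_l_closed[OF y(1) x] by auto
  qed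
qed

text \<open>Multiplication by \<open>c\<close> identifies \<open>B / (B \<inter> (Z : c))\<close> with \<open>(Z + c B) / Z\<close>.\<close>

lemma ideal_length_colon:
  assumes Z: "ideal Z R" and B: "ideal B R" and c: "c \<in> carrier R"
  shows "ideal_length R Z (Z <+> (\<otimes>) c ` B) = ideal_length R {x \<in> B. c \<otimes> x \<in> Z} B"
proof -
  let ?Y = "{x \<in> B. c \<otimes> x \<in> Z}"
  let ?F = "\<lambda>K. Z <+> (\<otimes>) c ` K"
  let ?G = "\<lambda>K. {x \<in> B. c \<otimes> x \<in> K}"
  interpret Z: ideal Z R by fact
  interpret B: ideal B R by fact
  have Y: "ideal ?Y R" using colon_ideal assms by blast
  have FY: "?F ?Y = Z"
    using ideal_sum_upper(1)[OF Z mult_image_ideal[OF Y c]] ideal_sum_least[OF Z, of Z "(\<otimes>) c ` ?Y"]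
    by auto
  have GX: "?G (?F B) = B"
    using ideal_sum_upper(2)[OF Z mult_image_ideal[OF B c]] by auto
  have "ideal_chain R Z (?F B) n" if ch: "ideal_chain R ?Y B n" for n
  proof -
    have "ideal_chain R (?F ?Y) (?F B) n"
    proof (rule ideal_chain_map[OF ch])
      fix K K' assume K: "ideal K R" "ideal K' R" "?Y \<subseteq> K" "K \<subset> K'" "K' \<subseteq> B"
      have sub: "?F K \<subseteq> ?F K'" using K(4) by (auto simp: set_add_def')
      obtain x where x: "x \<in> K'" "x \<notin> K" using K by auto
      have xc: "x \<in> carrier R" using ideal.Icarr[OF K(2) x(1)] .
      have cx: "c \<otimes> x \<in> ?F K'"
        using ideal_sum_upper(2)[OF Z mult_image_ideal[OF K(2) c]] x by auto
      have "c \<otimes> x \<notin> ?F K"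
      proof
        assume "c \<otimes> x \<in> ?F K"
        then obtain z y where zy: "z \<in> Z" "y \<in> K" "c \<otimes> x = z \<oplus> c \<otimes> y" by (auto simp: set_add_def')
        have car: "z \<in> carrier R" "y \<in> carrier R"
          using Z.Icarr[OF zy(1)] ideal.Icarr[OF K(1) zy(2)] by auto
        have "c \<otimes> (x \<ominus> y) = c \<otimes> x \<ominus> c \<otimes> y" using c xc car by algebra
        also have "\<dots> = z" unfolding zy(3) using c xc car by algebra
        finally have "c \<otimes> (x \<ominus> y) \<in> Z" using zy by simp
        moreover have "x \<ominus> y \<in> B" using ideal_minus[OF B] x(1) zy(2) K by blast
        ultimately have "x \<ominus> y \<in> K" using K(3) by auto
        then show False using ideal_minus_cancel[OF K(1) _ zy(2) xc] x(2) by blast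
      qed
      then show "?F K \<subset> ?F K'" using sub cx by blast
    qed (use add_ideals[OF Z mult_image_ideal[OF _ c]] in auto)
    then show ?thesis unfolding FY .
  qed
  moreover have "ideal_chain R ?Y B n" if ch: "ideal_chain R Z (?F B) n" for n
  proof -
    have "ideal_chain R (?G Z) (?G (?F B)) n"
    proof (rule ideal_chain_map[OF ch])
      fix K assume "ideal K R"
      then show "ideal (?G K) R" using colon_ideal B c by blast
    next
      fix K K' assume K: "ideal K R" "ideal K' R" "Z \<subseteq> K" "K \<subset> K'" "K' \<subseteq> ?F B"
      obtain w where w: "w \<in> K'" "w \<notin> K" using K by auto
      then obtain z x where zx: "z \<in> Z" "x \<in> B" "w = z \<oplus> c \<otimes> x" using K(5) by (auto simp: set_add_def')
      have car: "z \<in> carrier R" "x \<in> carrier R" using zx Z.Icarr B.Icarr by auto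
      have "c \<otimes> x = w \<ominus> z" unfolding zx(3) using car c by algebra
      then have "c \<otimes> x \<in> K'" using ideal_minus[OF K(2) w(1)] zx(1) K by auto
      moreover have "c \<otimes> x \<notin> K"
        using w(2) zx K(3) additive_subgroup.a_closed[OF ideal.axioms(1)[OF K(1)]] by auto
      ultimately show "?G K \<subset> ?G K'" using K(4) zx(2) by auto
    qed
    then show ?thesis unfolding GX .
  qed
  ultimately have "{enat n | n. ideal_chain R Z (?F B) n} = {enat n | n. ideal_chain R ?Y B n}" by blast
  then show ?thesis unfolding ideal_length_def by simp
qed

end

section \<open>The number of generators as a length of ideals\<close>

lemma ideal_chain_sequence:
  assumes "ideal_chain R L N n"
  shows "\<exists>f. (\<forall>i \<le> n. ideal (f i) R \<and> L \<subseteq> f i \<and> f i \<subseteq> N) \<and> (\<forall>i < n. f i \<subset> f (Suc i))"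
proof -
  have "\<exists>f. f n = N \<and> (\<forall>i \<le> n. ideal (f i) R \<and> L \<subseteq> f i \<and> f i \<subseteq> N) \<and> (\<forall>i < n. f i \<subset> f (Suc i))"
    using assms
  proof (induction rule: ideal_chain.induct)
    case (refl L)
    then show ?case by (intro exI[of _ "\<lambda>_. L"]) auto
  next
    case (step L K n N)
    then obtain f where f: "f n = K" "\<forall>i \<le> n. ideal (f i) R \<and> L \<subseteq> f i \<and> f i \<subseteq> K"
      "\<forall>i < n. f i \<subset> f (Suc i)" by blast
    have "L \<subseteq> N" using step.hyps f by blast
    have sub: "f i \<subseteq> N" if "i \<le> n" for i
      using f(2) that step.hyps(3) by (meson psubsetE subset_trans)
    let ?g = "f(Suc n := N)"
    have "?g (Suc n) = N" by simp
    moreover have "\<forall>i \<le> Suc n. ideal (?g i) R \<and> L \<subseteq> ?g i \<and> ?g i \<subseteq> N"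
      using f(2) sub step.hyps(2) \<open>L \<subseteq> N\<close> by (simp add: le_Suc_eq)
    moreover have "\<forall>i < Suc n. ?g i \<subset> ?g (Suc i)"
      using f(1,3) step.hyps(3) by (simp add: less_Suc_eq)
    ultimately show ?case by blast
  qed
  then show ?thesis by blast
qed

lemma sequence_ideal_chain:
  assumes "\<And>i. i \<le> n \<Longrightarrow> ideal (f i) R" "\<And>i. i < n \<Longrightarrow> f i \<subset> f (Suc i)"
  shows "ideal_chain R (f 0) (f n) n"
  using assms
proof (induction n)
  case 0
  then show ?case by (auto intro: ideal_chain.refl)
next
  case (Suc n)
  have "ideal_chain R (f 0) (f n) n"
    by (rule Suc.IH) (simp_all add: Suc.prems)
  then show ?case
    by (rule ideal_chain.step) (simp_all add: Suc.prems)
qed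

context cring
begin

context
  fixes K J assumes K: "ideal K R" and J: "ideal J R" and KJ: "K \<subseteq> J"
begin

abbreviation (input) Q where "Q \<equiv> quotient_module (ideal_module R J) K"

lemma carrier_quotient: "carrier Q = (\<lambda>x. K +> x) ` J"
  by (auto simp: quotient_module_def ring.defs module.defs FactRing_def A_RCOSETS_def RCOSETS_def
      ideal_module_def a_r_coset_def r_coset_def)

lemma add_quotient: "x \<in> J \<Longrightarrow> y \<in> J \<Longrightarrow> (K +> x) \<oplus>\<^bsub>Q\<^esub> (K +> y) = K +> (x \<oplus> y)"
  using ideal.a_rcos_sum[OF K, of x y] ideal.Icarr[OF J]
  by (simp add: quotient_module_def ring.defs module.defs FactRing_def
      ideal_module_def set_add_def set_mult_def)

lemma zero_quotient: "\<zero>\<^bsub>Q\<^esub> = K +> \<zero>"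
  using ring.a_rcos_zero[OF ring_axioms K] additive_subgroup.zero_closed[OF ideal.axioms(1)[OF K]]
  by (simp add: quotient_module_def ring.defs module.defs FactRing_def)

lemma coset_eq_iff:
  "x \<in> J \<Longrightarrow> y \<in> J \<Longrightarrow> K +> x = K +> y \<longleftrightarrow> x \<ominus> y \<in> K"
  using quotient_eq_iff_same_a_r_cos[OF K] ideal.Icarr[OF J] by auto

lemma smult_quotient:
  assumes a: "a \<in> carrier R" and x: "x \<in> J"
  shows "a \<odot>\<^bsub>Q\<^esub> (K +> x) = K +> (a \<otimes> x)"
proof -
  interpret K: ideal K R by (rule K)
  interpret J: ideal J R by (rule J)
  have coset: "K +> (a \<otimes> y) = K +> (a \<otimes> x)" if "y \<in> K +> x" for y
  proof -
    obtain h where h: "h \<in> K" "y = h \<oplus> x" using \<open>y \<in> K +> x\<close> by (auto simp: a_r_coset_def')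
    have "a \<otimes> y \<ominus> a \<otimes> x = a \<otimes> h"
      unfolding h(2) using a K.Icarr[OF h(1)] J.Icarr[OF x] by algebra
    then show ?thesis
      using coset_eq_iff[of "a \<otimes> y" "a \<otimes> x"] K.I_l_closed[OF h(1) a] J.I_l_closed a x h KJ
      by (auto simp: subset_eq)
  qed
  have "a \<odot>\<^bsub>Q\<^esub> (K +> x) = (\<Union>y \<in> K +> x. K +> (a \<otimes> y))"
    by (simp add: quotient_module_def ring.defs module.defs ideal_module_def a_r_coset_def r_coset_def)
  also have "\<dots> = (\<Union>y \<in> K +> x. K +> (a \<otimes> x))"
    by (rule SUP_cong[OF HOL.refl coset])
  also have "\<dots> = K +> (a \<otimes> x)"
    using K.a_rcos_self[OF J.Icarr[OF x]] by blast
  finally show ?thesis .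
qed

lemma preimage_submodule:
  assumes S: "submodule S R Q"
  shows "ideal {x \<in> J. K +> x \<in> S} R"
proof -
  interpret J: ideal J R by (rule J)
  interpret S: submodule S R Q by (rule S)
  let ?U = "{x \<in> J. K +> x \<in> S}"
  have mult: "a \<otimes> x \<in> ?U" if "a \<in> carrier R" "x \<in> ?U" for a x
  proof -
    have x: "x \<in> J" "K +> x \<in> S" using that(2) by auto
    have "K +> (a \<otimes> x) \<in> S"
      using S.smult_closed[OF that(1) x(2)] unfolding smult_quotient[OF that(1) x(1)] .
    then show ?thesis using J.I_l_closed[OF x(1) that(1)] by blast
  qed
  show ?thesis
  proof (rule idealI)
    show "ring R" by (rule ring_axioms)
    show "subgroup ?U (add_monoid R)"
    proof (rule add.subgroupI)
      show "?U \<subseteq> carrier R" using J.Icarr by auto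
      have "K +> \<zero> \<in> S" using S.one_closed zero_quotient by simp
      then show "?U \<noteq> {}" using J.zero_closed by blast
    next
      fix x assume x: "x \<in> ?U"
      have "\<ominus> x = (\<ominus> \<one>) \<otimes> x" using x J.Icarr by (simp add: l_minus)
      then show "\<ominus> x \<in> ?U" using mult[of "\<ominus> \<one>" x] x by simp
      fix y assume y: "y \<in> ?U"
      then show "x \<oplus> y \<in> ?U"
        using x S.m_closed[of "K +> x" "K +> y"] add_quotient[of x y] by auto
    qed
  next
    fix x a assume x: "x \<in> ?U" and a: "a \<in> carrier R"
    show "a \<otimes> x \<in> ?U" using mult a x by blast
    moreover have "x \<otimes> a = a \<otimes> x" using x a J.Icarr m_comm by auto
    ultimately show "x \<otimes> a \<in> ?U" by simp
  qed
qed

lemma image_submodule: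
  assumes N: "ideal N R" "N \<subseteq> J"
  shows "submodule ((\<lambda>x. K +> x) ` N) R Q"
proof -
  interpret N: ideal N R by (rule N)
  interpret J: ideal J R by (rule J)
  interpret K: ideal K R by (rule K)
  let ?V = "(\<lambda>x. K +> x) ` N"
  \<comment> \<open>The additive structure of the quotient has not been shown to be a group, so its inverses are
    read off from the definite description that defines them.\<close>
  have inv: "inv\<^bsub>add_monoid Q\<^esub> (K +> x) = K +> (\<ominus> x)" if x: "x \<in> J" for x
    unfolding m_inv_def
  proof (rule the_equality)
    show "K +> \<ominus> x \<in> carrier (add_monoid Q) \<and>
      (K +> x) \<otimes>\<^bsub>add_monoid Q\<^esub> (K +> \<ominus> x) = \<one>\<^bsub>add_monoid Q\<^esub> \<and>
      (K +> \<ominus> x) \<otimes>\<^bsub>add_monoid Q\<^esub> (K +> x) = \<one>\<^bsub>add_monoid Q\<^esub>"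
      using x J.Icarr by (simp add: carrier_quotient add_quotient zero_quotient r_neg l_neg)
  next
    fix C assume C: "C \<in> carrier (add_monoid Q) \<and>
      (K +> x) \<otimes>\<^bsub>add_monoid Q\<^esub> C = \<one>\<^bsub>add_monoid Q\<^esub> \<and>
      C \<otimes>\<^bsub>add_monoid Q\<^esub> (K +> x) = \<one>\<^bsub>add_monoid Q\<^esub>"
    then obtain y where y: "y \<in> J" "C = K +> y" using carrier_quotient by auto
    then have "K +> (x \<oplus> y) = K +> \<zero>" using C x by (simp add: add_quotient zero_quotient)
    then have "x \<oplus> y \<ominus> \<zero> \<in> K" using x y coset_eq_iff by auto
    moreover have "x \<oplus> y \<ominus> \<zero> = y \<ominus> \<ominus> x"
      using x y J.Icarr by (simp add: a_minus_def a_comm)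
    ultimately show "C = K +> \<ominus> x" using x y coset_eq_iff by auto
  qed
  show ?thesis
  proof (rule submodule.intro)
    show "subgroup ?V (add_monoid Q)"
    proof (rule subgroup.intro)
      show "?V \<subseteq> carrier (add_monoid Q)" using N carrier_quotient by auto
      show "\<one>\<^bsub>add_monoid Q\<^esub> \<in> ?V" using zero_quotient N.zero_closed by auto
    next
      fix C assume "C \<in> ?V"
      then obtain x where x: "x \<in> N" "C = K +> x" by auto
      then show "inv\<^bsub>add_monoid Q\<^esub> C \<in> ?V" using inv[of x] N(2) by auto
      fix D assume "D \<in> ?V"
      then obtain y where y: "y \<in> N" "D = K +> y" by auto
      then have "C \<otimes>\<^bsub>add_monoid Q\<^esub> D = K +> (x \<oplus> y)"
        using x N(2) by (auto simp: add_quotient subset_eq)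
      then show "C \<otimes>\<^bsub>add_monoid Q\<^esub> D \<in> ?V" using x y by auto
    qed
    show "submodule_axioms ?V R Q"
    proof
      fix a C assume a: "a \<in> carrier R" and "C \<in> ?V"
      then obtain x where x: "x \<in> N" "C = K +> x" by auto
      then have "a \<odot>\<^bsub>Q\<^esub> C = K +> (a \<otimes> x)" using a smult_quotient N(2) by auto
      then show "a \<odot>\<^bsub>Q\<^esub> C \<in> ?V" using N.I_l_closed[OF x(1) a] by auto
    qed
  qed
qed

text \<open>Preimages and images under \<open>J \<rightarrow> J / K\<close> carry chains of submodules to chains of ideals
  between \<open>K\<close> and \<open>J\<close> and back, keeping the inclusions strict. The ends of a chain of submodules
  are arbitrary, so the chain of preimages may have to be prolonged to reach \<open>K\<close> and \<open>J\<close>.\<close>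

lemma module_length_quotient: "module_length R Q = ideal_length R K J"
proof -
  interpret J: ideal J R by (rule J)
  interpret K: ideal K R by (rule K)
  let ?U = "\<lambda>S. {x \<in> J. K +> x \<in> S}"
  let ?A = "{n. \<exists>N. (\<forall>i \<le> n. submodule (N i) R Q) \<and> (\<forall>i < n. N i \<subset> N (Suc i))}"
  have 1: "\<exists>m \<ge> n. ideal_chain R K J m" if n: "n \<in> ?A" for n
  proof -
    obtain N where N: "\<forall>i \<le> n. submodule (N i) R Q" "\<forall>i < n. N i \<subset> N (Suc i)"
      using n by blast
    have sub: "S \<subseteq> (\<lambda>x. K +> x) ` J" if "submodule S R Q" for S
      using subgroup.subset[OF submodule.axioms(1)[OF that]] carrier_quotient by simp
    have "ideal_chain R (?U (N 0)) (?U (N n)) n"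
    proof (rule sequence_ideal_chain)
      fix i assume "i \<le> n"
      then show "ideal (?U (N i)) R" using N preimage_submodule by blast
    next
      fix i assume i: "i < n"
      then have "N i \<subset> N (Suc i)" "N (Suc i) \<subseteq> (\<lambda>x. K +> x) ` J"
        using N sub[of "N (Suc i)"] by auto
      then show "?U (N i) \<subset> ?U (N (Suc i))" by blast
    qed
    moreover have "K \<subseteq> ?U (N 0)"
    proof
      fix x assume x: "x \<in> K"
      have "\<zero>\<^bsub>Q\<^esub> \<in> N 0"
        using subgroup.one_closed[OF submodule.axioms(1)] N(1) by fastforce
      then have "K +> x \<in> N 0"
        using zero_quotient coset_eq_iff[of x \<zero>] x KJ K.Icarr by (auto simp: a_minus_def)
      then show "x \<in> ?U (N 0)" using x KJ by auto
    qed
    moreover have "ideal (?U (N 0)) R" using N preimage_submodule by blast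
    ultimately obtain p where "ideal_chain R K (?U (N n)) (p + n)"
      using exists_ideal_chain[OF K] ideal_chain_trans by blast
    then show ?thesis
      using ideal_chain_widen[OF _ J] by (metis (no_types, lifting) add_leD2 mem_Collect_eq subsetI)
  qed
  have 2: "n \<in> ?A" if n: "ideal_chain R K J n" for n
  proof -
    obtain f where f: "\<forall>i \<le> n. ideal (f i) R \<and> K \<subseteq> f i \<and> f i \<subseteq> J" "\<forall>i < n. f i \<subset> f (Suc i)"
      using ideal_chain_sequence[OF n] by blast
    have "(\<lambda>x. K +> x) ` f i \<subset> (\<lambda>x. K +> x) ` f (Suc i)" if i: "i < n" for i
    proof -
      obtain x where x: "x \<in> f (Suc i)" "x \<notin> f i" using f(2) i by blast
      have "K +> x \<notin> (\<lambda>x. K +> x) ` f i"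
      proof
        assume "K +> x \<in> (\<lambda>x. K +> x) ` f i"
        then obtain y where y: "y \<in> f i" "K +> x = K +> y" by auto
        have xJ: "x \<in> J" "y \<in> J" using f(1) i x y by (meson Suc_leI less_imp_le subsetD)+
        have fi: "ideal (f i) R" "K \<subseteq> f i" using f(1) i by auto
        have "x \<ominus> y \<in> f i" using coset_eq_iff[OF xJ] y(2) fi by auto
        then show False using ideal_minus_cancel[OF fi(1) _ y(1)] x(2) J.Icarr xJ by blast
      qed
      then show ?thesis using f(2) i x(1) by blast
    qed
    then have "(\<forall>i \<le> n. submodule ((\<lambda>x. K +> x) ` f i) R Q) \<and>
        (\<forall>i < n. (\<lambda>x. K +> x) ` f i \<subset> (\<lambda>x. K +> x) ` f (Suc i))"
      using image_submodule f(1) by blast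
    then show ?thesis by (auto intro!: exI[of _ "\<lambda>i. (\<lambda>x. K +> x) ` f i"])
  qed
  show ?thesis
  proof (rule enat_eqI)
    fix k
    have ne: "?A \<noteq> {}" using exists_ideal_chain[OF K J KJ] 2 by blast
    have "{enat n | n. \<exists>N. (\<forall>i \<le> n. submodule (N i) R Q) \<and> (\<forall>i < n. N i \<subset> N (Suc i))} = enat ` ?A"
      by auto
    then have "enat k \<le> module_length R Q \<longleftrightarrow> (\<exists>n \<in> ?A. k \<le> n)"
      unfolding module_length_def using enat_le_Sup_iff[OF ne, of k] by simp
    also have "\<dots> \<longleftrightarrow> (\<exists>n \<ge> k. ideal_chain R K J n)"
      using 1 2 order_trans by meson
    also have "\<dots> \<longleftrightarrow> enat k \<le> ideal_length R K J"
      using enat_le_ideal_length_iff[OF K J KJ] by simp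
    finally show "enat k \<le> module_length R Q \<longleftrightarrow> enat k \<le> ideal_length R K J" .
  qed
qed

end

lemma num_gens_eq_ideal_length:
  assumes "ideal I R" "ideal J R"
  shows "num_gens R I J = ideal_length R (ideal_prod R I J) J"
  unfolding num_gens_def
  using module_length_quotient[OF ideal_prod_is_ideal[OF assms] assms(2)] ideal_prod_inter[OF assms]
  by auto

end

section \<open>Powers of the maximal ideal and colengths\<close>

text \<open>Zorn's lemma applies because in a Noetherian ring the union of a chain of ideals is one of
  its members.\<close>

lemma (in noetherian_ring) exists_maximal_ideal_in:
  assumes "P \<noteq> {}" "\<And>I. I \<in> P \<Longrightarrow> ideal I R"
  shows "\<exists>M \<in> P. \<forall>I \<in> P. M \<subseteq> I \<longrightarrow> I = M"
proof (rule subset_Zorn_nonempty[OF assms(1)])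
  fix C assume C: "C \<noteq> {}" "subset.chain P C"
  then have "subset.chain {I. ideal I R} C"
    using assms(2) by (auto simp: pred_on.chain_def)
  then have "\<Union>C \<in> C" using ideal_chain_is_trivial C(1) by blast
  then show "\<Union>C \<in> P" using C(2) by (auto simp: pred_on.chain_def)
qed

lemma (in ring) ideal_length_maximalideal:
  assumes "maximalideal I R"
  shows "ideal_length R I (carrier R) \<le> 1"
proof -
  interpret I: maximalideal I R by fact
  have self: "n = 0" if "ideal_chain R I I n" for n
    using that by (cases rule: ideal_chain.cases) (auto dest: ideal_chain_ideals)
  have "n \<le> 1" if "ideal_chain R I (carrier R) n" for n
    using that
  proof (cases rule: ideal_chain.cases)
    case (step K n')
    have K: "ideal K R" "I \<subseteq> K" "K \<subset> carrier R"
      using ideal_chain_ideals[OF step(2)] step by auto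
    then have "K = I" using I.I_maximal[of K] by auto
    then show ?thesis using self[of n'] step by auto
  qed auto
  then show ?thesis unfolding ideal_length_def
    by (intro Sup_least) (auto simp: one_enat_def)
qed

context noetherian_local_ring
begin

definition mpow :: "nat \<Rightarrow> 'a set" where "mpow n = ideal_pow R \<mm> n"

lemma ideal_mm: "ideal \<mm> R"
  using is_maximalideal maximalideal.axioms(1) by blast

lemma mm_in_ideals_set: "\<mm> \<in> carrier (ideals_set R)"
  using ideal_mm by (simp add: ideals_set_def)

lemma mpow_ideal: "ideal (mpow n) R"
proof -
  interpret S: comm_monoid "ideals_set R" by (rule ideals_set_is_comm_monoid)
  show ?thesis using S.nat_pow_closed[OF mm_in_ideals_set, of n] by (simp add: ideals_set_def mpow_def)
qed

lemma mpow_add: "ideal_prod R (mpow p) (mpow q) = mpow (p + q)"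
proof -
  interpret S: comm_monoid "ideals_set R" by (rule ideals_set_is_comm_monoid)
  show ?thesis using S.nat_pow_mult[OF mm_in_ideals_set, of p q] by (simp add: ideals_set_def mpow_def)
qed

lemma mpow_0: "mpow 0 = carrier R"
  by (simp add: ideals_set_def mpow_def)

lemma mpow_1: "mpow (Suc 0) = \<mm>"
proof -
  interpret S: comm_monoid "ideals_set R" by (rule ideals_set_is_comm_monoid)
  show ?thesis using S.nat_pow_eone[OF mm_in_ideals_set] by (simp add: mpow_def)
qed

lemma mpow_Suc: "mpow (Suc n) = ideal_prod R \<mm> (mpow n)"
  using mpow_add[of "Suc 0" n] by (simp only: mpow_1) simp

lemma mpow_mult: "a \<in> mpow p \<Longrightarrow> b \<in> mpow q \<Longrightarrow> a \<otimes> b \<in> mpow (p + q)"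
  using ideal_prod.prod[of a "mpow p" b "mpow q" R] mpow_add by simp

lemma mm_mult: "a \<in> \<mm> \<Longrightarrow> b \<in> mpow q \<Longrightarrow> a \<otimes> b \<in> mpow (Suc q)"
  using mpow_mult[of a "Suc 0" b q] by (simp only: mpow_1) simp

lemma mpow_carr: "a \<in> mpow n \<Longrightarrow> a \<in> carrier R"
  by (rule ideal.Icarr[OF mpow_ideal])

lemma mm_carr: "a \<in> \<mm> \<Longrightarrow> a \<in> carrier R"
  by (rule ideal.Icarr[OF ideal_mm])

lemma mpow_zero: "\<zero> \<in> mpow n"
  using additive_subgroup.zero_closed[OF ideal.axioms(1)[OF mpow_ideal]] .

lemma mpow_add_closed: "x \<in> mpow n \<Longrightarrow> y \<in> mpow n \<Longrightarrow> x \<oplus> y \<in> mpow n"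
  using additive_subgroup.a_closed[OF ideal.axioms(1)[OF mpow_ideal]] .

lemma mpow_Suc_subset: "mpow (Suc n) \<subseteq> mpow n"
  using ideal_prod_inter[OF ideal_mm mpow_ideal[of n]] mpow_Suc by auto

lemma mpow_antimono: "p \<le> q \<Longrightarrow> mpow q \<subseteq> mpow p"
  by (rule lift_Suc_antimono_le[of mpow]) (use mpow_Suc_subset in auto)

text \<open>If \<open>r\<close> were not a unit, an ideal maximal among those that contain \<open>r\<close> and not \<open>\<one>\<close> would be
  a maximal ideal different from \<open>\<mm>\<close>.\<close>

lemma unit_if_not_in_mm:
  assumes r: "r \<in> carrier R" "r \<notin> \<mm>"
  shows "\<exists>s \<in> carrier R. s \<otimes> r = \<one>"
proof (rule ccontr)
  assume neg: "\<not> ?thesis"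
  let ?P = "{I. ideal I R \<and> r \<in> I \<and> \<one> \<notin> I}"
  have "\<one> \<notin> PIdl r" using neg by (auto simp: cgenideal_def)
  then have "PIdl r \<in> ?P" using cgenideal_ideal[OF r(1)] cgenideal_self[OF r(1)] by auto
  then obtain M where M: "M \<in> ?P" "\<forall>I \<in> ?P. M \<subseteq> I \<longrightarrow> I = M"
    using exists_maximal_ideal_in[of ?P] by blast
  have "maximalideal M R"
  proof (rule maximalidealI)
    show "ideal M R" "carrier R \<noteq> M" using M(1) by auto
    fix J assume J: "ideal J R" "M \<subseteq> J" "J \<subseteq> carrier R"
    show "J = M \<or> J = carrier R"
    proof (cases "\<one> \<in> J")
      case True
      then show ?thesis using ideal.one_imp_carrier[OF J(1)] by auto
    next
      case False
      then have "J \<in> ?P" using J M(1) by auto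
      then show ?thesis using M(2) J(2) by blast
    qed
  qed
  then show False using maximalideal_unique M(1) r(2) by blast
qed

text \<open>The quotient \<open>N / L\<close> is a finitely generated vector space over the residue field. Among
  the intermediate ideals at finite length from \<open>L\<close> there is a maximal one \<open>K\<close>; adjoining to it
  an element \<open>x\<close> of \<open>N\<close> adds at most the length of \<open>R / \<mm>\<close>, because \<open>\<mm>\<close> is contained in the
  colon ideal \<open>K : x\<close>. Hence \<open>K = N\<close>.\<close>

lemma ideal_length_finite_if_killed:
  assumes L: "ideal L R" and N: "ideal N R" and LN: "L \<subseteq> N"
    and kill: "\<And>a x. a \<in> \<mm> \<Longrightarrow> x \<in> N \<Longrightarrow> a \<otimes> x \<in> L"
  shows "ideal_length R L N < \<infinity>"
proof -
  let ?P = "{K. ideal K R \<and> L \<subseteq> K \<and> K \<subseteq> N \<and> ideal_length R L K < \<infinity>}"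
  have "L \<in> ?P" using L LN ideal_length_self[OF L] by (auto simp: zero_enat_def)
  then obtain K where K: "K \<in> ?P" "\<forall>I \<in> ?P. K \<subseteq> I \<longrightarrow> I = K"
    using exists_maximal_ideal_in[of ?P] by blast
  have "N \<subseteq> K"
  proof
    fix x assume x: "x \<in> N"
    have xc: "x \<in> carrier R" using ideal.Icarr[OF N x] .
    let ?xA = "(\<otimes>) x ` carrier R" and ?C = "{r \<in> carrier R. x \<otimes> r \<in> K}"
    have xA: "ideal ?xA R" using mult_image_ideal[OF oneideal xc] .
    have C: "ideal ?C R" using colon_ideal[OF _ oneideal xc] K(1) by blast
    have "\<mm> \<subseteq> ?C"
    proof
      fix a assume a: "a \<in> \<mm>"
      have "a \<otimes> x \<in> K" using kill[OF a x] K(1) by blast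
      then show "a \<in> ?C" using mm_carr[OF a] xc by (simp add: m_comm)
    qed
    then have "?C = \<mm> \<or> ?C = carrier R" using I_maximal[OF C] by auto
    then have "ideal_length R ?C (carrier R) \<le> 1"
      using ideal_length_maximalideal[OF is_maximalideal] ideal_length_self[OF oneideal] by auto
    then have fin: "ideal_length R K (K <+> ?xA) \<le> 1"
      using ideal_length_colon[OF _ oneideal xc] K(1) by auto
    have sum: "ideal (K <+> ?xA) R" "K \<subseteq> K <+> ?xA" "?xA \<subseteq> K <+> ?xA"
      using add_ideals ideal_sum_upper xA K(1) by auto
    have "?xA \<subseteq> N" using ideal.I_r_closed[OF N x] by auto
    then have "K <+> ?xA \<subseteq> N" using ideal_sum_least[OF N] K(1) by auto
    moreover have "ideal_length R L (K <+> ?xA) < \<infinity>"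
      using ideal_length_add[OF L _ sum(1) _ sum(2)] K(1) fin
      by (cases "ideal_length R L K"; cases "ideal_length R K (K <+> ?xA)") auto
    ultimately have "K <+> ?xA = K" using K sum by blast
    moreover have "x \<in> ?xA" using xc by (intro image_eqI[of _ _ \<one>]) auto
    ultimately show "x \<in> K" using sum(3) by auto
  qed
  then have "K = N" using K(1) by auto
  then show ?thesis using K(1) by auto
qed

lemma ideal_length_mpow_finite: "ideal_length R (mpow n) (carrier R) < \<infinity>"
proof (induction n)
  case 0
  show ?case unfolding mpow_0 ideal_length_self[OF oneideal] by (simp add: zero_enat_def)
next
  case (Suc n)
  have "ideal_length R (mpow (Suc n)) (mpow n) < \<infinity>"
    by (rule ideal_length_finite_if_killed[OF mpow_ideal mpow_ideal mpow_Suc_subset]) (rule mm_mult)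
  moreover have "mpow n \<subseteq> carrier R" using mpow_carr by auto
  ultimately show ?case
    using ideal_length_add[OF mpow_ideal mpow_ideal oneideal mpow_Suc_subset, of n] Suc
    by (cases "ideal_length R (mpow (Suc n)) (mpow n)"; cases "ideal_length R (mpow n) (carrier R)") auto
qed

text \<open>If \<open>L\<close> contains a power of \<open>\<mm>\<close>, then \<open>R / L\<close> has finite length, and the length of any
  interval above \<open>L\<close> is a difference of two natural numbers. All further counting is done in
  this form.\<close>

definition cofinite :: "'a set \<Rightarrow> bool" where
  "cofinite L \<longleftrightarrow> ideal L R \<and> (\<exists>k. mpow k \<subseteq> L)"

definition colength :: "'a set \<Rightarrow> nat" where
  "colength L = the_enat (ideal_length R L (carrier R))"

lemma cofinite_ideal: "cofinite L \<Longrightarrow> ideal L R"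
  by (simp add: cofinite_def)

lemma cofinite_mpow: "cofinite (mpow n)"
  using mpow_ideal by (auto simp: cofinite_def)

lemma cofinite_mono: "cofinite L \<Longrightarrow> L \<subseteq> N \<Longrightarrow> ideal N R \<Longrightarrow> cofinite N"
  by (auto simp: cofinite_def)

lemma cofinite_Int:
  assumes "cofinite L" "cofinite N"
  shows "cofinite (L \<inter> N)"
proof -
  obtain k j where kj: "mpow k \<subseteq> L" "mpow j \<subseteq> N" using assms by (auto simp: cofinite_def)
  have "mpow (max k j) \<subseteq> mpow k" "mpow (max k j) \<subseteq> mpow j" by (auto intro!: mpow_antimono)
  then show ?thesis
    using kj i_intersect[OF cofinite_ideal[OF assms(1)] cofinite_ideal[OF assms(2)]]
    unfolding cofinite_def by blast
qed

lemma cofinite_prod: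
  assumes "cofinite L" shows "cofinite (ideal_prod R \<mm> L)"
proof -
  obtain k where "mpow k \<subseteq> L" using assms by (auto simp: cofinite_def)
  then have "mpow (Suc k) \<subseteq> ideal_prod R \<mm> L" unfolding mpow_Suc by (rule ideal_prod_mono)
  then show ?thesis
    using ideal_prod_is_ideal[OF ideal_mm] assms unfolding cofinite_def by blast
qed

lemma ideal_length_colength:
  assumes "cofinite L"
  shows "ideal_length R L (carrier R) = enat (colength L)"
proof -
  obtain k where k: "mpow k \<subseteq> L" using assms by (auto simp: cofinite_def)
  have L: "ideal L R" "L \<subseteq> carrier R" using cofinite_ideal[OF assms] ideal_subset_carrier by auto
  have "ideal_length R (mpow k) (carrier R) = ideal_length R (mpow k) L + ideal_length R L (carrier R)"
    by (rule ideal_length_add[OF mpow_ideal L(1) oneideal k L(2)])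
  then have "ideal_length R L (carrier R) \<noteq> \<infinity>"
    using ideal_length_mpow_finite[of k] by (cases "ideal_length R (mpow k) L"; cases "ideal_length R L (carrier R)") auto
  then show ?thesis unfolding colength_def by auto
qed

lemma ideal_length_eq_colength_diff:
  assumes "cofinite L" "ideal N R" "L \<subseteq> N"
  shows "colength N \<le> colength L" "ideal_length R L N = enat (colength L - colength N)"
proof -
  have L: "ideal L R" using cofinite_ideal[OF assms(1)] .
  have N: "N \<subseteq> carrier R" using ideal_subset_carrier[OF assms(2)] .
  have "enat (colength L) = ideal_length R L N + enat (colength N)"
    using ideal_length_add[OF L assms(2) oneideal assms(3) N]
      ideal_length_colength[OF assms(1)] ideal_length_colength[OF cofinite_mono[OF assms(1,3,2)]] by simp
  then show "colength N \<le> colength L" "ideal_length R L N = enat (colength L - colength N)"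
    by (cases "ideal_length R L N"; auto)+
qed

lemma colength_strict:
  assumes "cofinite L" "ideal N R" "L \<subset> N"
  shows "colength N < colength L"
  using ideal_length_eq_colength_diff[of L N] ideal_length_pos[of L N] assms cofinite_ideal[of L]
  by (auto simp: one_enat_def)

lemma colength_eqD:
  assumes "cofinite L" "ideal N R" "L \<subseteq> N" "colength L \<le> colength N"
  shows "L = N"
  using colength_strict[of L N] assms by fastforce

text \<open>The rank formula for multiplication by \<open>c\<close>, as a map from \<open>B\<close> to \<open>R / Z\<close>.\<close>

lemma colength_colon:
  assumes Z: "cofinite Z" and B: "cofinite B" and c: "c \<in> carrier R"
  shows "colength Z + colength B = colength (Z <+> (\<otimes>) c ` B) + colength {x \<in> B. c \<otimes> x \<in> Z}"
proof -
  let ?Y = "{x \<in> B. c \<otimes> x \<in> Z}"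
  have i: "ideal Z R" "ideal B R" "ideal ((\<otimes>) c ` B) R"
    using Z B cofinite_ideal mult_image_ideal c by auto
  have Y: "cofinite ?Y"
    using cofinite_mono[OF cofinite_Int[OF Z B], of ?Y] colon_ideal[OF i(1,2) c]
      ideal.I_l_closed[OF i(1) _ c] by blast
  have "enat (colength Z - colength (Z <+> (\<otimes>) c ` B)) = enat (colength ?Y - colength B)"
    using ideal_length_colon[OF i(1,2) c]
      ideal_length_eq_colength_diff(2)[OF Z add_ideals[OF i(1,3)] ideal_sum_upper(1)[OF i(1,3)]]
      ideal_length_eq_colength_diff(2)[OF Y i(2)] by auto
  moreover have "colength (Z <+> (\<otimes>) c ` B) \<le> colength Z" "colength B \<le> colength ?Y"
    using ideal_length_eq_colength_diff(1)[OF Z add_ideals[OF i(1,3)] ideal_sum_upper(1)[OF i(1,3)]]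
      ideal_length_eq_colength_diff(1)[OF Y i(2)] by auto
  ultimately show ?thesis by auto
qed

lemma colength_modular:
  assumes "cofinite L" "cofinite N"
  shows "colength L + colength N = colength (L <+> N) + colength (L \<inter> N)"
proof -
  have N: "N \<subseteq> carrier R" using ideal_subset_carrier[OF cofinite_ideal[OF assms(2)]] .
  then have "(\<otimes>) \<one> ` N = N" by (auto simp: subset_eq image_iff)
  moreover have "{x \<in> N. \<one> \<otimes> x \<in> L} = L \<inter> N" using N by auto
  ultimately show ?thesis using colength_colon[OF assms one_closed] by simp
qed

lemma num_gens_eq_colength_diff:
  assumes "cofinite J"
  shows "num_gens R \<mm> J = enat (colength (ideal_prod R \<mm> J) - colength J)"
  using num_gens_eq_ideal_length[OF ideal_mm cofinite_ideal[OF assms]]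
    ideal_length_eq_colength_diff(2)[OF cofinite_prod[OF assms] cofinite_ideal[OF assms]]
    ideal_prod_inter[OF ideal_mm cofinite_ideal[OF assms]] by auto

end

section \<open>Subspaces of the graded pieces\<close>

context noetherian_local_ring
begin

text \<open>An ideal \<open>B\<close> between \<open>\<mm>\<^sup>i\<^sup>+\<^sup>1\<close> and \<open>\<mm>\<^sup>i\<close> stands for the subspace \<open>B / \<mm>\<^sup>i\<^sup>+\<^sup>1\<close> of the
  graded piece of degree \<open>i\<close>, with \<open>\<mm>\<^sup>i\<^sup>+\<^sup>1\<close> as the zero subspace and \<open>layer_dim i B\<close> as the
  dimension. The products \<open>\<mm>\<^sup>n B\<close> again have this form in degree \<open>n + i\<close>, so graded submodules
  generated in one degree are described without leaving the ring.\<close>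

definition layer :: "nat \<Rightarrow> 'a set \<Rightarrow> bool" where
  "layer i B \<longleftrightarrow> ideal B R \<and> mpow (Suc i) \<subseteq> B \<and> B \<subseteq> mpow i"

definition layer_dim :: "nat \<Rightarrow> 'a set \<Rightarrow> nat" where
  "layer_dim i B = colength (mpow (Suc i)) - colength B"

lemma layerD: "layer i B \<Longrightarrow> ideal B R" "layer i B \<Longrightarrow> mpow (Suc i) \<subseteq> B" "layer i B \<Longrightarrow> B \<subseteq> mpow i"
  by (auto simp: layer_def)

lemma layer_cofinite: "layer i B \<Longrightarrow> cofinite B"
  by (auto simp: layer_def cofinite_def)

lemma layer_dim_colength: "layer i B \<Longrightarrow> layer_dim i B + colength B = colength (mpow (Suc i))"
  unfolding layer_dim_def
  using ideal_length_eq_colength_diff(1)[OF cofinite_mpow, of B "Suc i"] by (auto simp: layer_def)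

lemma layer_dim_mono:
  assumes "layer i B" "layer i C" "B \<subseteq> C"
  shows "layer_dim i B \<le> layer_dim i C"
  using layer_dim_colength[OF assms(1)] layer_dim_colength[OF assms(2)]
    ideal_length_eq_colength_diff(1)[OF layer_cofinite[OF assms(1)] layerD(1)[OF assms(2)] assms(3)] by auto

lemma layer_eqI:
  assumes "layer i B" "layer i C" "B \<subseteq> C" "layer_dim i C \<le> layer_dim i B"
  shows "B = C"
  using layer_dim_colength[OF assms(1)] layer_dim_colength[OF assms(2)]
    colength_eqD[OF layer_cofinite[OF assms(1)] layerD(1)[OF assms(2)] assms(3)] assms(4) by auto

lemma layer_mpow_Suc: "layer i (mpow (Suc i))"
  using mpow_ideal mpow_Suc_subset by (auto simp: layer_def)

lemma layer_dim_mpow_Suc: "layer_dim i (mpow (Suc i)) = 0"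
  by (simp add: layer_dim_def)

lemma layer_dim_pos:
  assumes "layer i B" "B \<noteq> mpow (Suc i)"
  shows "layer_dim i B > 0"
  using layer_eqI[OF layer_mpow_Suc assms(1) layerD(2)[OF assms(1)]] assms(2) by fastforce

lemma layer_power:
  assumes "layer i B"
  shows "layer (n + i) (ideal_prod R (mpow n) B)"
proof -
  have "mpow (n + Suc i) \<subseteq> ideal_prod R (mpow n) B"
    using ideal_prod_mono[OF layerD(2)[OF assms], of "mpow n"] mpow_add by simp
  moreover have "ideal_prod R (mpow n) B \<subseteq> mpow (n + i)"
    using ideal_prod_mono[OF layerD(3)[OF assms], of "mpow n"] mpow_add by simp
  ultimately show ?thesis
    using ideal_prod_is_ideal[OF mpow_ideal layerD(1)[OF assms]] by (simp add: layer_def)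
qed

lemma power_0:
  assumes "ideal B R" shows "ideal_prod R (mpow 0) B = B"
  unfolding mpow_0 using ideal_prod_commute[OF oneideal assms] ideal_prod_one[OF assms] by simp

lemma power_power:
  assumes "ideal B R"
  shows "ideal_prod R (mpow j) (ideal_prod R (mpow n) B) = ideal_prod R (mpow (j + n)) B"
  using ideal_prod_assoc[OF mpow_ideal mpow_ideal assms, of j n] mpow_add[of j n] by simp

lemma mm_power:
  assumes "ideal B R"
  shows "ideal_prod R \<mm> (ideal_prod R (mpow n) B) = ideal_prod R (mpow (Suc n)) B"
  using power_power[OF assms, of "Suc 0" n] unfolding mpow_1 by simp

lemma layer_mm: "layer i B \<Longrightarrow> layer (Suc i) (ideal_prod R \<mm> B)"
  using layer_power[of i B "Suc 0"] unfolding mpow_1 by simp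

lemma layer_sum_image:
  assumes B: "layer i B" and Z: "layer (n + i) Z" and c: "c \<in> mpow n"
  shows "layer (n + i) (Z <+> (\<otimes>) c ` B)"
    and "layer i {x \<in> B. c \<otimes> x \<in> Z}"
    and "layer_dim (n + i) (Z <+> (\<otimes>) c ` B) + layer_dim i {x \<in> B. c \<otimes> x \<in> Z}
      = layer_dim (n + i) Z + layer_dim i B"
proof -
  have cc: "c \<in> carrier R" using mpow_carr c .
  note iB = layerD(1)[OF B] and iZ = layerD(1)[OF Z]
  note img = mult_image_ideal[OF iB cc]
  have "(\<otimes>) c ` B \<subseteq> mpow (n + i)" using mpow_mult[OF c] layerD(3)[OF B] by auto
  then show 1: "layer (n + i) (Z <+> (\<otimes>) c ` B)"
    using add_ideals[OF iZ img] ideal_sum_upper(1)[OF iZ img] layerD[OF Z]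
      ideal_sum_least[OF mpow_ideal, of Z "n + i" "(\<otimes>) c ` B"] unfolding layer_def by blast
  have "c \<otimes> x \<in> Z" if "x \<in> mpow (Suc i)" for x
    using mpow_mult[OF c that] layerD(2)[OF Z] by auto
  then show 2: "layer i {x \<in> B. c \<otimes> x \<in> Z}"
    using colon_ideal[OF iZ iB cc] layerD[OF B] unfolding layer_def by blast
  show "layer_dim (n + i) (Z <+> (\<otimes>) c ` B) + layer_dim i {x \<in> B. c \<otimes> x \<in> Z}
      = layer_dim (n + i) Z + layer_dim i B"
    using colength_colon[OF layer_cofinite[OF Z] layer_cofinite[OF B] cc]
      layer_dim_colength[OF 1] layer_dim_colength[OF 2] layer_dim_colength[OF B] layer_dim_colength[OF Z] by linarith
qed

lemma mm_sum_image:
  assumes "ideal Z R" "ideal B R" "c \<in> carrier R"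
  shows "ideal_prod R \<mm> (Z <+> (\<otimes>) c ` B) = ideal_prod R \<mm> Z <+> (\<otimes>) c ` ideal_prod R \<mm> B"
proof -
  note i = ideal_prod_is_ideal[OF ideal_mm assms(1)] ideal_prod_is_ideal[OF ideal_mm assms(2)]
    mult_image_ideal[OF assms(2,3)]
  have "ideal_prod R \<mm> ((\<otimes>) c ` B) = (\<otimes>) c ` ideal_prod R \<mm> B"
  proof
    show "ideal_prod R \<mm> ((\<otimes>) c ` B) \<subseteq> (\<otimes>) c ` ideal_prod R \<mm> B"
    proof (rule ideal_prod_least[OF mult_image_ideal[OF i(2) assms(3)]])
      fix a b assume a: "a \<in> \<mm>" and "b \<in> (\<otimes>) c ` B"
      then obtain x where x: "x \<in> B" "b = c \<otimes> x" by auto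
      have "a \<otimes> b = c \<otimes> (a \<otimes> x)"
        unfolding x(2) using mm_carr[OF a] ideal.Icarr[OF assms(2) x(1)] assms(3) by (simp add: m_lcomm)
      then show "a \<otimes> b \<in> (\<otimes>) c ` ideal_prod R \<mm> B" using ideal_prod.prod[OF a x(1)] by auto
    qed
  next
    note t = ideal_prod_is_ideal[OF ideal_mm i(3)]
    have "ideal_prod R \<mm> B \<subseteq> {x \<in> carrier R. c \<otimes> x \<in> ideal_prod R \<mm> ((\<otimes>) c ` B)}"
    proof (rule ideal_prod_least[OF colon_ideal[OF t oneideal assms(3)]])
      fix a x assume a: "a \<in> \<mm>" and x: "x \<in> B"
      have car: "a \<in> carrier R" "x \<in> carrier R" using mm_carr[OF a] ideal.Icarr[OF assms(2) x] .
      then have "c \<otimes> (a \<otimes> x) = a \<otimes> (c \<otimes> x)" using assms(3) by (simp add: m_lcomm)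
      then show "a \<otimes> x \<in> {x \<in> carrier R. c \<otimes> x \<in> ideal_prod R \<mm> ((\<otimes>) c ` B)}"
        using ideal_prod.prod[OF a, of "c \<otimes> x" "(\<otimes>) c ` B" R] x car by auto
    qed
    then show "(\<otimes>) c ` ideal_prod R \<mm> B \<subseteq> ideal_prod R \<mm> ((\<otimes>) c ` B)" by auto
  qed
  then show ?thesis using ideal_prod_r_distr[OF ideal_mm assms(1) i(3)] by simp
qed

text \<open>Write \<open>\<delta>(Y) = dim Y - dim \<mm> Y\<close> and suppose that \<open>B\<close> maximises \<open>\<delta>\<close> in degree \<open>i\<close>. Passing
  from \<open>Z\<close> to \<open>Z + c B\<close> raises the dimension by \<open>dim B - dim Y\<close>, where \<open>Y = B \<inter> (Z : c)\<close>. It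
  raises the dimension of \<open>\<mm> Z\<close> by at most \<open>dim \<mm> B - dim \<mm> Y\<close>, since \<open>c \<mm> Y \<subseteq> \<mm> Z\<close>. By
  maximality of \<open>\<delta>(B)\<close> the second increase is at most the first.\<close>

lemma defect_of_sum:
  assumes B: "layer i B" and Z: "layer (n + i) Z" and c: "c \<in> mpow n"
    and best: "\<And>Y. layer i Y \<Longrightarrow>
      layer_dim i Y + layer_dim (Suc i) (ideal_prod R \<mm> B)
      \<le> layer_dim i B + layer_dim (Suc i) (ideal_prod R \<mm> Y)"
  defines "C \<equiv> Z <+> (\<otimes>) c ` B"
  shows "layer_dim (Suc (n + i)) (ideal_prod R \<mm> C) + layer_dim (n + i) Z
    \<le> layer_dim (Suc (n + i)) (ideal_prod R \<mm> Z) + layer_dim (n + i) C"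
proof -
  let ?Y = "{x \<in> B. c \<otimes> x \<in> Z}"
  let ?Y' = "{x \<in> ideal_prod R \<mm> B. c \<otimes> x \<in> ideal_prod R \<mm> Z}"
  have cc: "c \<in> carrier R" using mpow_carr c .
  note iB = layerD(1)[OF B] and iZ = layerD(1)[OF Z]
  have mZ: "layer (n + Suc i) (ideal_prod R \<mm> Z)" using layer_mm[OF Z] by simp
  note 1 = layer_sum_image[OF B Z c]
  note 2 = layer_sum_image[OF layer_mm[OF B] mZ c]
  have "ideal_prod R \<mm> ?Y \<subseteq> ?Y'"
  proof (rule ideal_prod_least[OF layerD(1)[OF 2(2)]])
    fix a x assume a: "a \<in> \<mm>" and x: "x \<in> ?Y"
    have "c \<otimes> (a \<otimes> x) = a \<otimes> (c \<otimes> x)"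
      using mm_carr[OF a] ideal.Icarr[OF iB, of x] x cc by (simp add: m_lcomm)
    then show "a \<otimes> x \<in> ?Y'"
      using ideal_prod.prod[OF a, of x B R] ideal_prod.prod[OF a, of "c \<otimes> x" Z R] x by auto
  qed
  then have "layer_dim (Suc i) (ideal_prod R \<mm> ?Y) \<le> layer_dim (Suc i) ?Y'"
    using layer_dim_mono[OF layer_mm[OF 1(2)] 2(2)] by blast
  moreover have "layer_dim (n + Suc i) (ideal_prod R \<mm> C) + layer_dim (Suc i) ?Y'
    = layer_dim (n + Suc i) (ideal_prod R \<mm> Z) + layer_dim (Suc i) (ideal_prod R \<mm> B)"
    using 2(3) mm_sum_image[OF iZ iB cc] unfolding C_def by simp
  ultimately show ?thesis using best[OF 1(2)] 1(3) unfolding C_def by simp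
qed

text \<open>Let \<open>Z\<close> be maximal among the layers inside \<open>\<mm>\<^sup>n B\<close> with \<open>dim \<mm> Z \<le> dim Z\<close>; the zero layer
  is one of them. By \<open>defect_of_sum\<close>, adding \<open>c B\<close> with \<open>c \<in> \<mm>\<^sup>n\<close> preserves this property, so
  \<open>Z\<close> contains all these multiples and is \<open>\<mm>\<^sup>n B\<close>.\<close>

lemma power_dim_antimono:
  assumes B: "layer i B" and le: "layer_dim (Suc i) (ideal_prod R \<mm> B) \<le> layer_dim i B"
    and best: "\<And>Y. layer i Y \<Longrightarrow>
      layer_dim i Y + layer_dim (Suc i) (ideal_prod R \<mm> B)
      \<le> layer_dim i B + layer_dim (Suc i) (ideal_prod R \<mm> Y)"
  shows "layer_dim (Suc n + i) (ideal_prod R (mpow (Suc n)) B)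
    \<le> layer_dim (n + i) (ideal_prod R (mpow n) B)"
proof -
  note iB = layerD(1)[OF B] and L = layer_power[OF B, of n]
  let ?P = "{Z. layer (n + i) Z \<and> Z \<subseteq> ideal_prod R (mpow n) B \<and>
    layer_dim (Suc (n + i)) (ideal_prod R \<mm> Z) \<le> layer_dim (n + i) Z}"
  have "mpow (Suc (n + i)) \<in> ?P"
    using layer_mpow_Suc layerD(2)[OF L] layer_dim_mpow_Suc
    by (simp add: mpow_Suc[of "Suc (n + i)", symmetric])
  then obtain Z where Z: "Z \<in> ?P" "\<forall>Z' \<in> ?P. Z \<subseteq> Z' \<longrightarrow> Z' = Z"
    using exists_maximal_ideal_in[of ?P] layerD(1) by blast
  have "ideal_prod R (mpow n) B \<subseteq> Z"
  proof (rule ideal_prod_least)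
    show "ideal Z R" using Z(1) layerD(1) by blast
    fix c x assume c: "c \<in> mpow n" and x: "x \<in> B"
    let ?C = "Z <+> (\<otimes>) c ` B"
    have lZ: "layer (n + i) Z" using Z(1) by blast
    note img = mult_image_ideal[OF iB mpow_carr[OF c]]
    have "(\<otimes>) c ` B \<subseteq> ideal_prod R (mpow n) B" using ideal_prod.prod[OF c] by auto
    then have "?C \<subseteq> ideal_prod R (mpow n) B" using ideal_sum_least[OF layerD(1)[OF L]] Z(1) by blast
    moreover have "layer (n + i) ?C" by (rule layer_sum_image(1)[OF B lZ c])
    moreover have "layer_dim (Suc (n + i)) (ideal_prod R \<mm> ?C) \<le> layer_dim (n + i) ?C"
      using defect_of_sum[OF B lZ c best] Z(1) by auto
    ultimately have "?C = Z" using Z(2) ideal_sum_upper(1)[OF layerD(1)[OF lZ] img] by blast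
    then show "c \<otimes> x \<in> Z" using ideal_sum_upper(2)[OF layerD(1)[OF lZ] img] x by blast
  qed
  then have "Z = ideal_prod R (mpow n) B" using Z(1) by blast
  then show ?thesis using Z(1) mm_power[OF iB, of n] by simp
qed

text \<open>The nonzero layer with the largest \<open>dim B - dim \<mm> B\<close> is also optimal against the zero
  layer, because \<open>V\<close> shows that this maximum is nonnegative.\<close>

lemma exists_bounded_layer:
  assumes V: "layer i V" "V \<noteq> mpow (Suc i)"
    and le: "layer_dim (Suc i) (ideal_prod R \<mm> V) \<le> layer_dim i V"
  shows "\<exists>B e. layer i B \<and> B \<noteq> mpow (Suc i) \<and> (\<forall>n. layer_dim (n + i) (ideal_prod R (mpow n) B) \<le> e)"
proof -
  \<comment> \<open>Minimising this natural number is maximising \<open>dim B - dim \<mm> B\<close>; the constant keeps the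
    difference from being truncated.\<close>
  let ?m = "\<lambda>B. layer_dim (Suc i) (ideal_prod R \<mm> B) + (colength (mpow (Suc i)) - layer_dim i B)"
  obtain B where B: "layer i B" "B \<noteq> mpow (Suc i)"
    and min: "\<And>Y. layer i Y \<Longrightarrow> Y \<noteq> mpow (Suc i) \<Longrightarrow> ?m B \<le> ?m Y"
    using ex_has_least_nat[of "\<lambda>B. layer i B \<and> B \<noteq> mpow (Suc i)" V ?m] V by blast
  have D: "layer_dim i Y \<le> colength (mpow (Suc i))" for Y by (simp add: layer_dim_def)
  have leB: "layer_dim (Suc i) (ideal_prod R \<mm> B) \<le> layer_dim i B"
    using min[OF V] le D[of B] D[of V] by linarith
  have best: "layer_dim i Y + layer_dim (Suc i) (ideal_prod R \<mm> B)
      \<le> layer_dim i B + layer_dim (Suc i) (ideal_prod R \<mm> Y)" if "layer i Y" for Y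
  proof (cases "Y = mpow (Suc i)")
    case True
    then show ?thesis using leB layer_dim_mpow_Suc by simp
  next
    case False
    then show ?thesis using min[OF that False] D[of B] D[of Y] by linarith
  qed
  have "layer_dim (n + i) (ideal_prod R (mpow n) B) \<le> layer_dim i B" for n
  proof (induction n)
    case 0
    then show ?case using power_0[OF layerD(1)[OF B(1)]] by simp
  next
    case (Suc n)
    then show ?case using power_dim_antimono[OF B(1) leB best, of n] by linarith
  qed
  then show ?thesis using B by blast
qed

end

section \<open>Bounded Hilbert functions are excluded by depth two\<close>

text \<open>In terms of the associated graded ring \<open>G\<close> and the residue field \<open>k\<close>, the first condition
  says that no nonzero homogeneous element of \<open>G\<close> is killed by \<open>G\<^sub>1\<close>, that is \<open>Hom(k, G) = 0\<close>.
  In the other two, the elements \<open>y a\<close> describe a homomorphism from the ideal \<open>G\<^sub>+\<close> to \<open>G\<close> that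
  sends the class of \<open>a\<close> in \<open>G\<^sub>1\<close> to that of \<open>y a\<close>. It has to be multiplication by a homogeneous
  element \<open>z\<close>, as it is when \<open>Ext\<^sup>1(k, G) = 0\<close>; if it lowers degrees, then \<open>z\<close> has negative
  degree and the map is zero.\<close>

locale local_ring_depth_two = noetherian_local_ring +
  assumes socle_vanishes:
    "\<lbrakk>c \<in> mpow n; \<And>a. a \<in> \<mm> \<Longrightarrow> a \<otimes> c \<in> mpow (n + 2)\<rbrakk> \<Longrightarrow> c \<in> mpow (n + 1)"
  and hom_is_mult:
    "\<lbrakk>\<And>a. a \<in> \<mm> \<Longrightarrow> y a \<in> mpow (n + 1);
      \<And>a b. a \<in> \<mm> \<Longrightarrow> b \<in> \<mm> \<Longrightarrow> a \<otimes> y b \<ominus> b \<otimes> y a \<in> mpow (n + 3)\<rbrakk>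
     \<Longrightarrow> \<exists>z \<in> mpow n. \<forall>a \<in> \<mm>. y a \<ominus> a \<otimes> z \<in> mpow (n + 2)"
  and hom_negative_degree:
    "\<lbrakk>\<And>a. a \<in> \<mm> \<Longrightarrow> y a \<in> carrier R;
      \<And>a b. a \<in> \<mm> \<Longrightarrow> b \<in> \<mm> \<Longrightarrow> a \<otimes> y b \<ominus> b \<otimes> y a \<in> mpow 2; a \<in> \<mm>\<rbrakk>
     \<Longrightarrow> y a \<in> \<mm>"
begin

lemma socle_vanishes_power:
  assumes "c \<in> mpow n" "\<And>s. s \<in> mpow N \<Longrightarrow> s \<otimes> c \<in> mpow (n + N + 1)"
  shows "c \<in> mpow (n + 1)"
  using assms(2)
proof (induction N)
  case 0
  then have "\<one> \<otimes> c \<in> mpow (n + 0 + 1)" using mpow_0 by blast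
  then show ?case using mpow_carr[OF assms(1)] by simp
next
  case (Suc N)
  show ?case
  proof (rule Suc.IH)
    fix s assume s: "s \<in> mpow N"
    have "s \<otimes> c \<in> mpow (n + N)" using mpow_mult[OF s assms(1)] by (simp add: add.commute)
    moreover have "a \<otimes> (s \<otimes> c) \<in> mpow (n + N + 2)" if a: "a \<in> \<mm>" for a
    proof -
      have "(a \<otimes> s) \<otimes> c \<in> mpow (n + Suc N + 1)" using Suc.prems[OF mm_mult[OF a s]] .
      then show ?thesis using mm_carr[OF a] mpow_carr[OF s] mpow_carr[OF assms(1)]
        by (simp add: m_assoc)
    qed
    ultimately show "s \<otimes> c \<in> mpow (n + N + 1)" using socle_vanishes by blast
  qed
qed

text \<open>The submodule generated by \<open>x\<close> agrees with the one generated by \<open>B\<close> in some degree \<open>j + n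
  + i\<close>, and \<open>a\<close> kills it. So \<open>\<mm>\<^sup>j\<^sup>+\<^sup>n\<close> multiplies \<open>a w\<close> to zero in the associated graded ring,
  and then \<open>a w\<close> itself is zero there.\<close>

lemma annihilator_of_minimal:
  assumes B: "layer i B"
    and min: "\<And>n Y. layer (n + i) Y \<Longrightarrow> Y \<subseteq> ideal_prod R (mpow n) B \<Longrightarrow> Y \<noteq> mpow (Suc (n + i)) \<Longrightarrow>
      \<exists>j. ideal_prod R (mpow j) Y = ideal_prod R (mpow (j + n)) B"
    and a: "a \<in> \<mm>" and x: "x \<in> ideal_prod R (mpow n) B" "x \<notin> mpow (Suc (n + i))"
    and ax: "a \<otimes> x \<in> mpow (n + i + 2)" and w: "w \<in> B"
  shows "a \<otimes> w \<in> mpow (i + 2)"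
proof -
  let ?Y = "mpow (Suc (n + i)) <+> (\<otimes>) x ` carrier R"
  note L = layer_power[OF B, of n] and ac = mm_carr[OF a] and wc = ideal.Icarr[OF layerD(1)[OF B] w]
  have xc: "x \<in> carrier R" using ideal.Icarr[OF layerD(1)[OF L] x(1)] .
  note xA = mult_image_ideal[OF oneideal xc]
  have xY: "x \<in> (\<otimes>) x ` carrier R" using xc by (intro image_eqI[of _ _ \<one>]) auto
  have sub: "(\<otimes>) x ` carrier R \<subseteq> ideal_prod R (mpow n) B"
    using ideal.I_r_closed[OF layerD(1)[OF L] x(1)] by auto
  have YB: "?Y \<subseteq> ideal_prod R (mpow n) B"
    using ideal_sum_least[OF layerD(1)[OF L] layerD(2)[OF L] sub] .
  have lY: "layer (n + i) ?Y"
    using add_ideals[OF mpow_ideal xA] ideal_sum_upper(1)[OF mpow_ideal xA] YB layerD(3)[OF L]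
    unfolding layer_def by blast
  have "?Y \<noteq> mpow (Suc (n + i))" using ideal_sum_upper(2)[OF mpow_ideal xA] xY x(2) by blast
  then obtain j where j: "ideal_prod R (mpow j) ?Y = ideal_prod R (mpow (j + n)) B"
    using min[OF lY YB] by blast
  have aY: "a \<otimes> y \<in> mpow (n + i + 2)" if y: "y \<in> ?Y" for y
  proof -
    obtain u r where ur: "u \<in> mpow (Suc (n + i))" "r \<in> carrier R" "y = u \<oplus> x \<otimes> r"
      using y by (auto simp: set_add_def')
    have "a \<otimes> u \<in> mpow (n + i + 2)" using mm_mult[OF a ur(1)] by simp
    moreover have "(a \<otimes> x) \<otimes> r \<in> mpow (n + i + 2)"
      using ideal.I_r_closed[OF mpow_ideal ax ur(2)] .
    moreover have "a \<otimes> y = a \<otimes> u \<oplus> (a \<otimes> x) \<otimes> r"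
      unfolding ur(3) using ac xc ur(2) mpow_carr[OF ur(1)] by algebra
    ultimately show ?thesis
      using additive_subgroup.a_closed[OF ideal.axioms(1)[OF mpow_ideal]] by simp
  qed
  have ajY: "ideal_prod R (mpow j) ?Y \<subseteq> {t \<in> carrier R. a \<otimes> t \<in> mpow (j + (n + i + 2))}"
  proof (rule ideal_prod_least[OF colon_ideal[OF mpow_ideal oneideal ac]])
    fix p y assume p: "p \<in> mpow j" and y: "y \<in> ?Y"
    have c: "p \<in> carrier R" "y \<in> carrier R"
      using mpow_carr[OF p] ideal.Icarr[OF layerD(1)[OF lY] y] .
    have "a \<otimes> (p \<otimes> y) = p \<otimes> (a \<otimes> y)" using c ac by (simp add: m_lcomm)
    then show "p \<otimes> y \<in> {t \<in> carrier R. a \<otimes> t \<in> mpow (j + (n + i + 2))}"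
      using mpow_mult[OF p aY[OF y]] c by simp
  qed
  have "a \<otimes> w \<in> mpow ((i + 1) + 1)"
  proof (rule socle_vanishes_power[where N = "j + n"])
    show "a \<otimes> w \<in> mpow (i + 1)" using mm_mult[OF a] w layerD(3)[OF B] by auto
    fix s assume s: "s \<in> mpow (j + n)"
    have "s \<otimes> w \<in> ideal_prod R (mpow j) ?Y" unfolding j by (rule ideal_prod.prod[OF s w])
    then have "a \<otimes> (s \<otimes> w) \<in> mpow (j + (n + i + 2))" using ajY by auto
    then show "s \<otimes> (a \<otimes> w) \<in> mpow (i + 1 + (j + n) + 1)"
      using mpow_carr[OF s] ac wc by (simp add: m_lcomm ac_simps)
  qed
  then show ?thesis by simp
qed

text \<open>Let \<open>M\<close> be the graded module generated by the layer \<open>B\<close>, and \<open>h\<close> a linear form that is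
  injective on \<open>M\<close> and maps each component of degree at least \<open>n0 + i\<close> onto the next one. The
  saturation of \<open>M\<close> consists in degree \<open>N\<close> of the elements that are multiplied into \<open>M\<close> by all
  forms of degree \<open>n0 + i - N\<close>. It agrees with \<open>M\<close> from degree \<open>n0 + i\<close> on: there the truncated
  difference is \<open>0\<close>, and the forms of degree \<open>0\<close> include \<open>\<one>\<close>. Unlike \<open>M\<close> it is divisible by \<open>h\<close>
  in all degrees.\<close>

context
  fixes i n0 :: nat and B and h
  assumes B: "layer i B" and h: "h \<in> \<mm>"
    and inj: "\<And>n x. x \<in> ideal_prod R (mpow n) B \<Longrightarrow> h \<otimes> x \<in> mpow (n + i + 2) \<Longrightarrow> x \<in> mpow (n + i + 1)"
    and surj: "\<And>n. n \<ge> n0 \<Longrightarrow>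
      ideal_prod R (mpow (Suc n)) B = mpow (n + i + 2) <+> (\<otimes>) h ` ideal_prod R (mpow n) B"
begin

definition saturation :: "nat \<Rightarrow> 'a set" where
  "saturation N = {y \<in> mpow N. \<forall>s \<in> mpow (n0 + i - N). s \<otimes> y \<in> ideal_prod R (mpow (max N (n0 + i) - i)) B}"

lemma base_ideal: "ideal B R" by (rule layerD(1)[OF B])

lemma h_carrier: "h \<in> carrier R" by (rule mm_carr[OF h])

lemma base_power_ideal: "ideal (ideal_prod R (mpow n) B) R"
  by (rule ideal_prod_is_ideal[OF mpow_ideal base_ideal])

lemma saturation_mpow: "y \<in> saturation N \<Longrightarrow> y \<in> mpow N"
  by (simp add: saturation_def)

lemma saturation_ge:
  assumes "N \<ge> n0 + i"
  shows "saturation N = ideal_prod R (mpow (N - i)) B"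
proof
  have eq: "n0 + i - N = 0" "max N (n0 + i) - i = N - i" using assms by auto
  show "saturation N \<subseteq> ideal_prod R (mpow (N - i)) B"
  proof
    fix y assume y: "y \<in> saturation N"
    then have "\<one> \<otimes> y \<in> ideal_prod R (mpow (N - i)) B"
      unfolding saturation_def eq mpow_0 by blast
    then show "y \<in> ideal_prod R (mpow (N - i)) B" using mpow_carr[OF saturation_mpow[OF y]] by simp
  qed
  have "ideal_prod R (mpow (N - i)) B \<subseteq> mpow N"
    using layerD(3)[OF layer_power[OF B, of "N - i"]] assms by simp
  then show "ideal_prod R (mpow (N - i)) B \<subseteq> saturation N"
    unfolding saturation_def eq mpow_0 using ideal.I_l_closed[OF base_power_ideal] by blast
qed

lemma saturation_minus:
  assumes "x \<in> saturation N" "y \<in> saturation N" shows "x \<ominus> y \<in> saturation N"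
proof -
  have c: "x \<in> carrier R" "y \<in> carrier R" using assms saturation_mpow mpow_carr by auto
  have "s \<otimes> (x \<ominus> y) \<in> ideal_prod R (mpow (max N (n0 + i) - i)) B" if s: "s \<in> mpow (n0 + i - N)" for s
  proof -
    have "s \<otimes> (x \<ominus> y) = s \<otimes> x \<ominus> s \<otimes> y" using c mpow_carr[OF s] by algebra
    then show ?thesis using ideal_minus[OF base_power_ideal] assms s unfolding saturation_def by auto
  qed
  moreover have "x \<ominus> y \<in> mpow N" using ideal_minus[OF mpow_ideal] assms saturation_mpow by blast
  ultimately show ?thesis unfolding saturation_def by blast
qed

lemma saturation_mult:
  assumes y: "y \<in> saturation N" and a: "a \<in> \<mm>"
  shows "a \<otimes> y \<in> saturation (Suc N)"
proof -
  have c: "y \<in> carrier R" "a \<in> carrier R" using y a saturation_mpow mpow_carr mm_carr by auto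
  have "s \<otimes> (a \<otimes> y) \<in> ideal_prod R (mpow (max (Suc N) (n0 + i) - i)) B"
    if s: "s \<in> mpow (n0 + i - Suc N)" for s
  proof (cases "N \<ge> n0 + i")
    case True
    then have "y \<in> ideal_prod R (mpow (N - i)) B" using y saturation_ge by blast
    then have "a \<otimes> y \<in> ideal_prod R (mpow (Suc (N - i))) B"
      using ideal_prod.prod[OF a] mm_power[OF base_ideal, of "N - i"] by blast
    moreover have "Suc (N - i) = max (Suc N) (n0 + i) - i" using True by auto
    ultimately show ?thesis using ideal.I_l_closed[OF base_power_ideal _ mpow_carr[OF s]] by metis
  next
    case False
    then have eq: "n0 + i - N = Suc (n0 + i - Suc N)" "max (Suc N) (n0 + i) = max N (n0 + i)" by auto
    have "a \<otimes> s \<in> mpow (n0 + i - N)" using mm_mult[OF a s] eq by simp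
    then have "(a \<otimes> s) \<otimes> y \<in> ideal_prod R (mpow (max N (n0 + i) - i)) B"
      using y unfolding saturation_def by blast
    moreover have "(a \<otimes> s) \<otimes> y = s \<otimes> (a \<otimes> y)" using c mpow_carr[OF s] by algebra
    ultimately show ?thesis using eq by simp
  qed
  moreover have "a \<otimes> y \<in> mpow (Suc N)" using mm_mult[OF a saturation_mpow[OF y]] .
  ultimately show ?thesis unfolding saturation_def by blast
qed

lemma mpow_Suc_subset_saturation: "mpow (Suc N) \<subseteq> saturation N"
proof
  fix y assume y: "y \<in> mpow (Suc N)"
  have "s \<otimes> y \<in> ideal_prod R (mpow (max N (n0 + i) - i)) B" if s: "s \<in> mpow (n0 + i - N)" for s
  proof -
    have "n0 + i - N + Suc N = Suc ((max N (n0 + i) - i) + i)" by auto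
    then have "s \<otimes> y \<in> mpow (Suc ((max N (n0 + i) - i) + i))" using mpow_mult[OF s y] by simp
    then show ?thesis using layerD(2)[OF layer_power[OF B]] by blast
  qed
  then show "y \<in> saturation N" using y mpow_Suc_subset unfolding saturation_def by blast
qed

lemma saturation_lift:
  assumes N: "N < n0 + i" and z: "z \<in> mpow N" and az: "\<And>a. a \<in> \<mm> \<Longrightarrow> a \<otimes> z \<in> saturation (Suc N)"
  shows "z \<in> saturation N"
proof -
  let ?W = "ideal_prod R (mpow (max N (n0 + i) - i)) B"
  have eq: "n0 + i - N = Suc (n0 + i - Suc N)" "max (Suc N) (n0 + i) = max N (n0 + i)" using N by auto
  note zc = mpow_carr[OF z]
  have "mpow (n0 + i - N) \<subseteq> {s \<in> carrier R. z \<otimes> s \<in> ?W}"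
    unfolding eq(1) mpow_Suc
  proof (rule ideal_prod_least[OF colon_ideal[OF base_power_ideal oneideal zc]])
    fix a b assume a: "a \<in> \<mm>" and b: "b \<in> mpow (n0 + i - Suc N)"
    have "b \<otimes> (a \<otimes> z) \<in> ?W" using az[OF a] b eq(2) unfolding saturation_def by simp
    moreover have "b \<otimes> (a \<otimes> z) = z \<otimes> (a \<otimes> b)" using mm_carr[OF a] mpow_carr[OF b] zc by algebra
    ultimately show "a \<otimes> b \<in> {s \<in> carrier R. z \<otimes> s \<in> ?W}"
      using mm_carr[OF a] mpow_carr[OF b] by simp
  qed
  then have "s \<otimes> z \<in> ?W" if "s \<in> mpow (n0 + i - N)" for s
    using that mpow_carr[OF that] zc m_comm[of z s] by auto
  then show ?thesis unfolding saturation_def using z by blast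
qed

text \<open>Multiplying by all forms of degree \<open>n0 + i - N\<close> moves the question into \<open>M\<close>, where \<open>h\<close> is
  injective; an element all of whose products vanish is zero.\<close>

lemma saturation_inj:
  assumes y: "y \<in> saturation N" and hy: "h \<otimes> y \<in> mpow (N + 2)"
  shows "y \<in> mpow (N + 1)"
proof (rule socle_vanishes_power[where N = "n0 + i - N"])
  show "y \<in> mpow N" using saturation_mpow[OF y] .
  fix s assume s: "s \<in> mpow (n0 + i - N)"
  let ?n = "max N (n0 + i) - i"
  have "s \<otimes> y \<in> ideal_prod R (mpow ?n) B" using y s unfolding saturation_def by blast
  moreover have "h \<otimes> (s \<otimes> y) = s \<otimes> (h \<otimes> y)"
    using mpow_carr[OF s] h_carrier mpow_carr[OF saturation_mpow[OF y]] by (simp add: m_lcomm)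
  moreover have "n0 + i - N + (N + 2) = ?n + i + 2" by auto
  ultimately have "s \<otimes> y \<in> mpow (?n + i + 1)" using inj mpow_mult[OF s hy] by metis
  moreover have "?n + i + 1 = N + (n0 + i - N) + 1" by auto
  ultimately show "s \<otimes> y \<in> mpow (N + (n0 + i - N) + 1)" by simp
qed

text \<open>For \<open>x\<close> in the saturation the products \<open>a x\<close> with \<open>a \<in> \<mm>\<close> lie one degree higher, so they
  can be divided by \<open>h\<close>. The quotients \<open>y a\<close> satisfy \<open>h a y(b) = a b x = h b y(a)\<close> modulo higher
  powers of \<open>\<mm>\<close>, and \<open>h\<close> cancels.\<close>

lemma quotient_by_h:
  assumes div: "\<And>x. x \<in> saturation (Suc N) \<Longrightarrow> \<exists>v \<in> saturation N. x \<ominus> h \<otimes> v \<in> mpow (N + 2)"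
    and x: "x \<in> saturation N"
  obtains y where "\<And>a. a \<in> \<mm> \<Longrightarrow> y a \<in> saturation N"
    and "\<And>a. a \<in> \<mm> \<Longrightarrow> a \<otimes> x \<ominus> h \<otimes> y a \<in> mpow (N + 2)"
    and "\<And>a b. a \<in> \<mm> \<Longrightarrow> b \<in> \<mm> \<Longrightarrow> a \<otimes> y b \<ominus> b \<otimes> y a \<in> mpow (N + 2)"
proof -
  have "\<forall>a \<in> \<mm>. \<exists>v \<in> saturation N. a \<otimes> x \<ominus> h \<otimes> v \<in> mpow (N + 2)"
    using div saturation_mult[OF x] by blast
  then obtain y where y: "\<forall>a \<in> \<mm>. y a \<in> saturation N \<and> a \<otimes> x \<ominus> h \<otimes> y a \<in> mpow (N + 2)"
    by metis
  have "a \<otimes> y b \<ominus> b \<otimes> y a \<in> mpow (N + 2)" if a: "a \<in> \<mm>" and b: "b \<in> \<mm>" for a b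
  proof -
    have c: "a \<in> carrier R" "b \<in> carrier R" "y a \<in> carrier R" "y b \<in> carrier R" "x \<in> carrier R"
      using a b y x mm_carr saturation_mpow mpow_carr by blast+
    have "b \<otimes> (a \<otimes> x \<ominus> h \<otimes> y a) \<in> mpow (Suc (N + 2))" "a \<otimes> (b \<otimes> x \<ominus> h \<otimes> y b) \<in> mpow (Suc (N + 2))"
      using mm_mult a b y by auto
    then have "b \<otimes> (a \<otimes> x \<ominus> h \<otimes> y a) \<ominus> a \<otimes> (b \<otimes> x \<ominus> h \<otimes> y b) \<in> mpow (Suc (N + 2))"
      using ideal_minus[OF mpow_ideal] by blast
    moreover have "b \<otimes> (a \<otimes> x \<ominus> h \<otimes> y a) \<ominus> a \<otimes> (b \<otimes> x \<ominus> h \<otimes> y b)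
        = h \<otimes> (a \<otimes> y b \<ominus> b \<otimes> y a)"
      using c h_carrier by algebra
    ultimately have "h \<otimes> (a \<otimes> y b \<ominus> b \<otimes> y a) \<in> mpow (Suc N + 2)" by simp
    moreover have "a \<otimes> y b \<ominus> b \<otimes> y a \<in> saturation (Suc N)"
      using saturation_minus saturation_mult a b y by blast
    ultimately show ?thesis using saturation_inj[of _ "Suc N"] by auto
  qed
  then show ?thesis using that y by blast
qed

text \<open>Downward induction on the degree. Below degree \<open>n0 + i\<close> the quotients \<open>a x / h\<close> are \<open>a z\<close>
  for one element \<open>z\<close> by \<open>hom_is_mult\<close>, so that \<open>x - h z\<close> is killed by all linear forms. The
  element \<open>z\<close> lies in the saturation because its products with linear forms do.\<close>

lemma saturation_divisible: "x \<in> saturation (Suc N) \<Longrightarrow> \<exists>v \<in> saturation N. x \<ominus> h \<otimes> v \<in> mpow (N + 2)"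
proof (induction "n0 + i - N" arbitrary: N x)
  case 0
  then have ge: "N \<ge> n0 + i" by simp
  have "x \<in> ideal_prod R (mpow (Suc (N - i))) B"
    using 0(2) saturation_ge[of "Suc N"] ge by (simp add: Suc_diff_le)
  then have "x \<in> mpow (N - i + i + 2) <+> (\<otimes>) h ` ideal_prod R (mpow (N - i)) B"
    using surj[of "N - i"] ge by auto
  then obtain u v where uv: "u \<in> mpow (N + 2)" "v \<in> saturation N" "x = u \<oplus> h \<otimes> v"
    using ge saturation_ge[OF ge] by (auto simp: set_add_def')
  have "x \<ominus> h \<otimes> v = u"
    unfolding uv(3) using mpow_carr[OF uv(1)] mpow_carr[OF saturation_mpow[OF uv(2)]] h_carrier by algebra
  then show ?case using uv(1,2) by (intro bexI[of _ v]) simp_all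
next
  case (Suc k)
  have N: "N < n0 + i" and k: "k = n0 + i - Suc N" using Suc(2) by auto
  note x = Suc.prems
  obtain y where y: "\<And>a. a \<in> \<mm> \<Longrightarrow> y a \<in> saturation (Suc N)"
    "\<And>a. a \<in> \<mm> \<Longrightarrow> a \<otimes> x \<ominus> h \<otimes> y a \<in> mpow (Suc N + 2)"
    "\<And>a b. a \<in> \<mm> \<Longrightarrow> b \<in> \<mm> \<Longrightarrow> a \<otimes> y b \<ominus> b \<otimes> y a \<in> mpow (Suc N + 2)"
    using quotient_by_h[OF Suc.hyps(1)[OF k] x] by metis
  obtain z where z: "z \<in> mpow N" "\<And>a. a \<in> \<mm> \<Longrightarrow> y a \<ominus> a \<otimes> z \<in> mpow (N + 2)"
    using hom_is_mult[of y N] y(1,3) saturation_mpow by (auto simp: numeral_3_eq_3 numeral_2_eq_2)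
  note zc = mpow_carr[OF z(1)] and xc = mpow_carr[OF saturation_mpow[OF x]]
  have yc: "y a \<in> carrier R" if "a \<in> \<mm>" for a using mpow_carr[OF saturation_mpow[OF y(1)[OF that]]] .
  have "a \<otimes> z \<in> saturation (Suc N)" if a: "a \<in> \<mm>" for a
  proof -
    have "y a \<ominus> a \<otimes> z \<in> saturation (Suc N)" using z(2)[OF a] mpow_Suc_subset_saturation[of "Suc N"] by auto
    then have "y a \<ominus> (y a \<ominus> a \<otimes> z) \<in> saturation (Suc N)" using saturation_minus y(1)[OF a] by blast
    moreover have "y a \<ominus> (y a \<ominus> a \<otimes> z) = a \<otimes> z" using yc[OF a] mm_carr[OF a] zc by algebra
    ultimately show ?thesis by simp
  qed
  then have "z \<in> saturation N" using saturation_lift[OF N z(1)] by blast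
  moreover have "x \<ominus> h \<otimes> z \<in> mpow (N + 1 + 1)"
  proof (rule socle_vanishes)
    have "h \<otimes> z \<in> mpow (Suc N)" using mm_mult[OF h z(1)] .
    then show "x \<ominus> h \<otimes> z \<in> mpow (N + 1)" using ideal_minus[OF mpow_ideal] saturation_mpow[OF x] by simp
    fix a assume a: "a \<in> \<mm>"
    have "h \<otimes> (y a \<ominus> a \<otimes> z) \<in> mpow (Suc (N + 2))" using mm_mult[OF h z(2)[OF a]] .
    then have "(a \<otimes> x \<ominus> h \<otimes> y a) \<oplus> h \<otimes> (y a \<ominus> a \<otimes> z) \<in> mpow (N + 1 + 2)"
      using mpow_add_closed[OF y(2)[OF a], of "h \<otimes> (y a \<ominus> a \<otimes> z)"] by simp
    moreover have "(a \<otimes> x \<ominus> h \<otimes> y a) \<oplus> h \<otimes> (y a \<ominus> a \<otimes> z) = a \<otimes> (x \<ominus> h \<otimes> z)"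
      using xc zc h_carrier yc[OF a] mm_carr[OF a] by algebra
    ultimately show "a \<otimes> (x \<ominus> h \<otimes> z) \<in> mpow (N + 1 + 2)" by simp
  qed
  ultimately show ?case by auto
qed

text \<open>Here the quotients \<open>a x / h\<close> have degree \<open>0\<close> and are therefore zero by
  \<open>hom_negative_degree\<close>.\<close>

lemma saturation_0: "saturation 0 \<subseteq> mpow 1"
proof
  fix x assume x: "x \<in> saturation 0"
  obtain y where y: "\<And>a. a \<in> \<mm> \<Longrightarrow> y a \<in> saturation 0"
    "\<And>a. a \<in> \<mm> \<Longrightarrow> a \<otimes> x \<ominus> h \<otimes> y a \<in> mpow (0 + 2)"
    "\<And>a b. a \<in> \<mm> \<Longrightarrow> b \<in> \<mm> \<Longrightarrow> a \<otimes> y b \<ominus> b \<otimes> y a \<in> mpow (0 + 2)"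
    using quotient_by_h[OF saturation_divisible x] by metis
  have xc: "x \<in> carrier R" using mpow_carr[OF saturation_mpow[OF x]] .
  have yc: "y a \<in> carrier R" if "a \<in> \<mm>" for a using mpow_carr[OF saturation_mpow[OF y(1)[OF that]]] .
  have "x \<in> mpow (0 + 1)"
  proof (rule socle_vanishes)
    show "x \<in> mpow 0" using saturation_mpow[OF x] .
    fix a assume a: "a \<in> \<mm>"
    have "y a \<in> \<mm>" by (rule hom_negative_degree[of y a]) (use yc y(3) a in \<open>simp_all add: numeral_2_eq_2\<close>)
    then have "h \<otimes> y a \<in> mpow (0 + 2)" using mm_mult[OF h, of "y a" "Suc 0"] mpow_1 by (simp add: numeral_2_eq_2)
    then have "(a \<otimes> x \<ominus> h \<otimes> y a) \<oplus> h \<otimes> y a \<in> mpow (0 + 2)"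
      using mpow_add_closed y(2)[OF a] by blast
    moreover have "(a \<otimes> x \<ominus> h \<otimes> y a) \<oplus> h \<otimes> y a = a \<otimes> x"
      using xc h_carrier yc[OF a] mm_carr[OF a] by algebra
    ultimately show "a \<otimes> x \<in> mpow (0 + 2)" by simp
  qed
  then show "x \<in> mpow 1" by simp
qed

lemma saturation_trivial: "saturation N \<subseteq> mpow (Suc N)"
proof (induction N)
  case 0
  then show ?case using saturation_0 by simp
next
  case (Suc N)
  show ?case
  proof
    fix x assume x: "x \<in> saturation (Suc N)"
    then obtain v where v: "v \<in> saturation N" "x \<ominus> h \<otimes> v \<in> mpow (N + 2)" using saturation_divisible by blast
    have "h \<otimes> v \<in> mpow (N + 2)" using mm_mult[OF h] v(1) Suc by auto
    then show "x \<in> mpow (Suc (Suc N))"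
      using ideal_minus_cancel[OF mpow_ideal v(2)] mpow_carr[OF saturation_mpow[OF x]] by simp
  qed
qed

lemma power_trivial: "ideal_prod R (mpow n0) B = mpow (Suc (n0 + i))"
  using saturation_trivial[of "n0 + i"] saturation_ge[of "n0 + i"] layerD(2)[OF layer_power[OF B, of n0]] by auto

end

end

context local_ring_depth_two
begin

text \<open>Induction on the bound makes it minimal: a nonzero submodule with a smaller bound is
  excluded, so every nonzero layer inside some \<open>\<mm>\<^sup>n B\<close> attains the bound \<open>e\<close> in some degree and
  coincides there with the module generated by \<open>B\<close>. Multiplication by \<open>h\<close> is injective on that
  module, so its dimensions do not decrease; once \<open>e\<close> is attained, \<open>h\<close> is bijective between
  consecutive components.\<close>

lemma no_bounded_layer:
  "layer i B \<Longrightarrow> \<forall>n. layer_dim (n + i) (ideal_prod R (mpow n) B) \<le> e \<Longrightarrow> B = mpow (Suc i)"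
proof (induction e arbitrary: i B rule: less_induct)
  case (less e i B)
  show ?case
  proof (rule ccontr)
    assume B0: "B \<noteq> mpow (Suc i)"
    note B = less.prems(1) and bound = less.prems(2)[rule_format]
    note iB = layerD(1)[OF B] and LB = layer_power[OF B]
    have top: "\<exists>j. layer_dim (j + (n + i)) (ideal_prod R (mpow j) Y) = e \<and>
        ideal_prod R (mpow j) Y = ideal_prod R (mpow (j + n)) B"
      if Y: "layer (n + i) Y" "Y \<subseteq> ideal_prod R (mpow n) B" "Y \<noteq> mpow (Suc (n + i))" for n Y
    proof -
      have "\<exists>j. layer_dim (j + (n + i)) (ideal_prod R (mpow j) Y) \<ge> e"
      proof (rule ccontr)
        assume neg: "\<not> ?thesis"
        then have lt: "layer_dim (j + (n + i)) (ideal_prod R (mpow j) Y) < e" for j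
          by (meson linorder_not_le)
        have "e - 1 < e" using lt[of 0] by linarith
        moreover have "layer_dim (j + (n + i)) (ideal_prod R (mpow j) Y) \<le> e - 1" for j
          using lt[of j] by linarith
        ultimately show False using less.IH[of "e - 1" "n + i" Y] Y by blast
      qed
      then obtain j where j: "layer_dim (j + (n + i)) (ideal_prod R (mpow j) Y) \<ge> e" by blast
      have sub: "ideal_prod R (mpow j) Y \<subseteq> ideal_prod R (mpow (j + n)) B"
        using ideal_prod_mono[OF Y(2), of "mpow j"] power_power[OF iB] by simp
      have lay: "layer (j + (n + i)) (ideal_prod R (mpow (j + n)) B)"
        using LB[of "j + n"] by (simp add: add.assoc)
      have le: "layer_dim (j + (n + i)) (ideal_prod R (mpow (j + n)) B) \<le> e"
        using bound[of "j + n"] by (simp add: add.assoc)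
      have "ideal_prod R (mpow j) Y = ideal_prod R (mpow (j + n)) B"
        by (rule layer_eqI[OF layer_power[OF Y(1), of j] lay sub order_trans[OF le j]])
      then show ?thesis using j le by (intro exI[of _ j]) simp
    qed
    have "\<exists>h \<in> \<mm>. \<exists>w \<in> B. h \<otimes> w \<notin> mpow (i + 2)"
    proof (rule ccontr)
      assume neg: "\<not> ?thesis"
      have "w \<in> mpow (i + 1)" if w: "w \<in> B" for w
        by (rule socle_vanishes) (use neg w layerD(3)[OF B] in auto)
      then show False using B0 layerD(2)[OF B] by auto
    qed
    then obtain h w where h: "h \<in> \<mm>" "w \<in> B" "h \<otimes> w \<notin> mpow (i + 2)" by blast
    have min: "\<exists>j. ideal_prod R (mpow j) Y = ideal_prod R (mpow (j + n)) B"
      if "layer (n + i) Y" "Y \<subseteq> ideal_prod R (mpow n) B" "Y \<noteq> mpow (Suc (n + i))" for n Y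
      using top[OF that] by blast
    have inj: "x \<in> mpow (n + i + 1)"
      if x: "x \<in> ideal_prod R (mpow n) B" "h \<otimes> x \<in> mpow (n + i + 2)" for n x
    proof (rule ccontr)
      assume "\<not> ?thesis"
      then have "x \<notin> mpow (Suc (n + i))" by simp
      from annihilator_of_minimal[OF B min h(1) x(1) this x(2) h(2)] show False using h(3) by blast
    qed
    \<comment> \<open>The image of the component of degree \<open>n + i\<close> under multiplication by \<open>h\<close>.\<close>
    let ?S = "\<lambda>n. mpow (n + i + 2) <+> (\<otimes>) h ` ideal_prod R (mpow n) B"
    have S: "layer (Suc n + i) (?S n)" "?S n \<subseteq> ideal_prod R (mpow (Suc n)) B"
      "layer_dim (Suc n + i) (?S n) = layer_dim (n + i) (ideal_prod R (mpow n) B)" for n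
    proof -
      have lZ: "layer (Suc 0 + (n + i)) (mpow (n + i + 2))"
        using layer_mpow_Suc[of "Suc (n + i)"] by simp
      have h1: "h \<in> mpow (Suc 0)" using h(1) mpow_1 by simp
      note 1 = layer_sum_image[OF LB[of n] lZ h1]
      show "layer (Suc n + i) (?S n)" using 1(1) by simp
      have "{x \<in> ideal_prod R (mpow n) B. h \<otimes> x \<in> mpow (n + i + 2)} = mpow (Suc (n + i))"
        using inj[of _ n] layerD(2)[OF LB[of n]] mm_mult[OF h(1), of _ "Suc (n + i)"] by auto
      then show "layer_dim (Suc n + i) (?S n) = layer_dim (n + i) (ideal_prod R (mpow n) B)"
        using 1(3) layer_dim_mpow_Suc[of "Suc (n + i)"] layer_dim_mpow_Suc[of "n + i"] by simp
      have "(\<otimes>) h ` ideal_prod R (mpow n) B \<subseteq> ideal_prod R (mpow (Suc n)) B"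
        using ideal_prod.prod[OF h(1)] mm_power[OF iB, of n] by auto
      then show "?S n \<subseteq> ideal_prod R (mpow (Suc n)) B"
        using ideal_sum_least[OF layerD(1)[OF LB] layerD(2)[OF LB[of "Suc n"]]] by simp
    qed
    obtain j where j: "layer_dim (j + i) (ideal_prod R (mpow j) B) = e"
      using top[of 0 B] B B0 power_0[OF iB] by auto
    have const: "layer_dim (n + i) (ideal_prod R (mpow n) B) = e" if "n \<ge> j" for n
      using that
    proof (induction n rule: dec_induct)
      case base
      then show ?case using j .
    next
      case (step n)
      have "layer_dim (Suc n + i) (?S n) \<le> layer_dim (Suc n + i) (ideal_prod R (mpow (Suc n)) B)"
        by (rule layer_dim_mono[OF S(1) LB S(2)])
      then show ?case using step.IH S(3)[of n] bound[of "Suc n"] by linarith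
    qed
    have surj: "ideal_prod R (mpow (Suc n)) B = ?S n" if "n \<ge> j" for n
      using layer_eqI[OF S(1) LB S(2)] S(3)[of n] const[of n] const[of "Suc n"] that
      by (metis le_SucI order_refl)
    have "ideal_prod R (mpow j) B = mpow (Suc (j + i))"
      by (rule power_trivial[OF B h(1) inj surj])
    then have "e = 0" using j layer_dim_mpow_Suc by metis
    then show False using layer_dim_pos[OF B B0] bound[of 0] power_0[OF iB] by simp
  qed
qed

lemma layer_dim_increases:
  assumes B: "layer i B" and B0: "B \<noteq> mpow (Suc i)"
  shows "layer_dim i B < layer_dim (Suc i) (ideal_prod R \<mm> B)"
proof (rule ccontr)
  assume "\<not> ?thesis"
  then obtain B' e where "layer i B'" "B' \<noteq> mpow (Suc i)"
    "\<forall>n. layer_dim (n + i) (ideal_prod R (mpow n) B') \<le> e"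
    using exists_bounded_layer[OF B B0] by (meson linorder_not_less)
  then show False using no_bounded_layer by blast
qed

end

section \<open>Strong Rees property of the powers\<close>

context local_ring_depth_two
begin

text \<open>Both sides change in a controlled way when \<open>J \<inter> \<mm>\<^sup>i\<^sup>+\<^sup>1\<close> is replaced by \<open>J \<inter> \<mm>\<^sup>i\<close>. The
  length of the ideal itself grows by the dimension of the layer \<open>B = (J \<inter> \<mm>\<^sup>i) + \<mm>\<^sup>i\<^sup>+\<^sup>1\<close>, and
  the length of its product with \<open>\<mm>\<close> by at least that of \<open>\<mm> B = \<mm> (J \<inter> \<mm>\<^sup>i) + \<mm>\<^sup>i\<^sup>+\<^sup>2\<close>, as \<open>\<mm> (J
  \<inter> \<mm>\<^sup>i\<^sup>+\<^sup>1)\<close> lies in \<open>\<mm> (J \<inter> \<mm>\<^sup>i) \<inter> \<mm>\<^sup>i\<^sup>+\<^sup>2\<close>. The steps are added up from \<open>i = l\<close>, where the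
  ideal is \<open>\<mm>\<^sup>l\<close>, down to \<open>i = 0\<close>, where it is \<open>J\<close>.\<close>

lemma colength_increment:
  assumes J: "ideal J R" and l: "mpow l \<subset> J"
  shows "colength (mpow l) + colength (ideal_prod R \<mm> J) < colength (mpow (Suc l)) + colength J"
proof -
  let ?J = "\<lambda>i. J \<inter> mpow i"
  have cJ: "cofinite (?J i)" if "i \<le> l" for i
    using cofinite_Int[OF _ cofinite_mpow] cofinite_mono[OF cofinite_mpow _ J] l by blast
  have cJ': "cofinite (ideal_prod R \<mm> (?J i))" if "i \<le> l" for i
    using cofinite_prod[OF cJ[OF that]] .
  have one_step: "colength (?J (Suc i)) + colength (ideal_prod R \<mm> (?J i)) \<le> colength (ideal_prod R \<mm> (?J (Suc i))) + colength (?J i) \<and>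
      (?J (Suc i) \<noteq> ?J i \<longrightarrow>
       colength (?J (Suc i)) + colength (ideal_prod R \<mm> (?J i)) < colength (ideal_prod R \<mm> (?J (Suc i))) + colength (?J i))"
    if i: "i < l" for i
  proof -
    let ?B = "?J i <+> mpow (Suc i)"
    have ii: "i \<le> l" "Suc i \<le> l" using i by auto
    note iJ = cofinite_ideal[OF cJ[OF ii(1)]] and iJS = cofinite_ideal[OF cJ[OF ii(2)]]
    note imJ = cofinite_ideal[OF cJ'[OF ii(1)]]
    have lB: "layer i ?B"
      using add_ideals[OF iJ mpow_ideal] ideal_sum_upper(2)[OF iJ mpow_ideal]
        ideal_sum_least[OF mpow_ideal, of "?J i" i "mpow (Suc i)"] mpow_Suc_subset[of i]
      unfolding layer_def by blast
    have int: "?J i \<inter> mpow (Suc i) = ?J (Suc i)" using mpow_Suc_subset[of i] by auto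
    have mB: "ideal_prod R \<mm> ?B = ideal_prod R \<mm> (?J i) <+> mpow (Suc (Suc i))"
      using ideal_prod_r_distr[OF ideal_mm iJ mpow_ideal] mpow_Suc[of "Suc i"] by simp
    have "ideal_prod R \<mm> (?J (Suc i)) \<subseteq> ideal_prod R \<mm> (?J i) \<inter> mpow (Suc (Suc i))"
      using ideal_prod_mono[of "?J (Suc i)" "?J i" \<mm>] mpow_Suc_subset[of i]
        ideal_prod_mono[of "?J (Suc i)" "mpow (Suc i)" \<mm>] mpow_Suc[of "Suc i"] by auto
    then have "colength (ideal_prod R \<mm> (?J i) \<inter> mpow (Suc (Suc i))) \<le> colength (ideal_prod R \<mm> (?J (Suc i)))"
      using ideal_length_eq_colength_diff(1)[OF cJ'[OF ii(2)]] i_intersect[OF imJ mpow_ideal] by blast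
    moreover have "colength (?J i) + colength (mpow (Suc i)) = colength ?B + colength (?J (Suc i))"
      using colength_modular[OF cJ[OF ii(1)] cofinite_mpow, of "Suc i"] int by simp
    moreover have "colength (ideal_prod R \<mm> (?J i)) + colength (mpow (Suc (Suc i)))
      = colength (ideal_prod R \<mm> ?B) + colength (ideal_prod R \<mm> (?J i) \<inter> mpow (Suc (Suc i)))"
      using colength_modular[OF cJ'[OF ii(1)] cofinite_mpow, of "Suc (Suc i)"] mB by simp
    moreover note layer_dim_colength[OF lB] layer_dim_colength[OF layer_mm[OF lB]]
    moreover have "layer_dim i ?B \<le> layer_dim (Suc i) (ideal_prod R \<mm> ?B)"
    proof (cases "?B = mpow (Suc i)")
      case True
      then show ?thesis using layer_dim_mpow_Suc by simp
    next
      case False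
      then show ?thesis using layer_dim_increases[OF lB] by simp
    qed
    moreover have "layer_dim i ?B < layer_dim (Suc i) (ideal_prod R \<mm> ?B)" if "?J (Suc i) \<noteq> ?J i"
    proof -
      have "?B \<noteq> mpow (Suc i)"
        using that int ideal_sum_upper(1)[OF iJ mpow_ideal, of "Suc i"] by blast
      then show ?thesis using layer_dim_increases[OF lB] by simp
    qed
    ultimately show ?thesis by linarith
  qed
  have "colength (?J l) + colength (ideal_prod R \<mm> (?J i)) \<le> colength (ideal_prod R \<mm> (?J l)) + colength (?J i) \<and>
      (?J l \<noteq> ?J i \<longrightarrow>
       colength (?J l) + colength (ideal_prod R \<mm> (?J i)) < colength (ideal_prod R \<mm> (?J l)) + colength (?J i))"
    if "i \<le> l" for i
    using that
  proof (induction i rule: inc_induct)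
    case base
    then show ?case by simp
  next
    case (step i)
    note 1 = one_step[OF \<open>i < l\<close>]
    show ?case
    proof (intro conjI impI)
      show "colength (?J l) + colength (ideal_prod R \<mm> (?J i)) \<le> colength (ideal_prod R \<mm> (?J l)) + colength (?J i)"
        using step.IH 1 by linarith
    next
      assume "?J l \<noteq> ?J i"
      then consider "?J l \<noteq> ?J (Suc i)" | "?J (Suc i) \<noteq> ?J i" by metis
      then show "colength (?J l) + colength (ideal_prod R \<mm> (?J i)) < colength (ideal_prod R \<mm> (?J l)) + colength (?J i)"
      proof cases
        case 1
        then show ?thesis using step.IH one_step[OF \<open>i < l\<close>] by linarith
      next
        case 2
        then show ?thesis using step.IH one_step[OF \<open>i < l\<close>] by linarith
      qed
    qed
  qed
  moreover have "?J l = mpow l" using l by auto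
  moreover have "?J 0 = J" using ideal_subset_carrier[OF J] mpow_0 by auto
  ultimately show ?thesis using l mpow_Suc[of l] by (metis le0 psubsetE subset_refl)
qed

lemma num_gens_less:
  assumes J: "ideal J R" and l: "mpow l \<subset> J"
  shows "num_gens R \<mm> J < num_gens R \<mm> (mpow l)"
proof -
  have cJ: "cofinite J" using cofinite_mono[OF cofinite_mpow _ J] l by blast
  have "colength J \<le> colength (ideal_prod R \<mm> J)"
    using ideal_length_eq_colength_diff(1)[OF cofinite_prod[OF cJ] J] ideal_prod_inter[OF ideal_mm J] by blast
  moreover have "colength (mpow l) \<le> colength (mpow (Suc l))"
    using ideal_length_eq_colength_diff(1)[OF cofinite_mpow mpow_ideal mpow_Suc_subset] .
  ultimately show ?thesis
    using num_gens_eq_colength_diff[OF cJ] num_gens_eq_colength_diff[OF cofinite_mpow, of l]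
      colength_increment[OF assms] mpow_Suc[of l] by simp
qed

end

context noetherian_local_ring
begin

lemma pow_mem_mpow: "x \<in> \<mm> \<Longrightarrow> x [^] n \<in> mpow n"
proof (induction n)
  case 0
  then show ?case using mpow_0 by simp
next
  case (Suc n)
  then show ?case using mpow_mult[OF Suc.IH[OF Suc.prems], of x "Suc 0"] mpow_1 by simp
qed

lemma unit_cancel_ideal:
  assumes I: "ideal I R" and b: "b \<in> carrier R" "b \<notin> \<mm>" and a: "a \<in> carrier R" "a \<otimes> b \<in> I"
  shows "a \<in> I"
proof -
  obtain s where s: "s \<in> carrier R" "s \<otimes> b = \<one>" using unit_if_not_in_mm[OF b] by blast
  have "s \<otimes> (a \<otimes> b) = a \<otimes> (s \<otimes> b)" using s(1) a(1) b(1) by (simp add: m_lcomm)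
  then have "s \<otimes> (a \<otimes> b) = a" using s(2) a(1) by simp
  then show ?thesis using ideal.I_l_closed[OF I a(2) s(1)] by simp
qed

lemma mpow_proper:
  assumes "l \<ge> 1" shows "mpow l \<subseteq> \<mm>" "\<one> \<notin> mpow l"
proof -
  show 1: "mpow l \<subseteq> \<mm>" using mpow_antimono[of "Suc 0" l] assms mpow_1 by simp
  have "\<one> \<notin> \<mm>" using one_imp_carrier I_notcarr by auto
  then show "\<one> \<notin> mpow l" using 1 by auto
qed

lemma primary_mpow:
  assumes "l \<ge> 1" shows "primary_ideal R (mpow l)"
  unfolding primary_ideal_def
proof (intro conjI ballI impI mpow_ideal)
  show "mpow l \<noteq> carrier R" using mpow_proper[OF assms] by auto
  fix a b assume ab: "a \<in> carrier R" "b \<in> carrier R" "a \<otimes> b \<in> mpow l"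
  show "a \<in> mpow l \<or> (\<exists>n::nat. b [^] n \<in> mpow l)"
    using unit_cancel_ideal[OF mpow_ideal ab(2) _ ab(1,3)] pow_mem_mpow by blast
qed

lemma radical_mpow:
  assumes "l \<ge> 1" shows "radical R (mpow l) = \<mm>"
proof
  show "\<mm> \<subseteq> radical R (mpow l)"
    using pow_mem_mpow mm_carr by (auto simp: radical_def)
  have "x \<in> \<mm>" if x: "x \<in> carrier R" "x [^] (n::nat) \<in> mpow l" for x n
  proof (rule ccontr)
    assume neg: "x \<notin> \<mm>"
    have "x [^] k \<in> mpow l \<Longrightarrow> \<one> \<in> mpow l" for k :: nat
    proof (induction k)
      case 0
      then show ?case by simp
    next
      case (Suc k)
      then show ?case using unit_cancel_ideal[OF mpow_ideal x(1) neg, of "x [^] k"] x(1) by simp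
    qed
    then show False using x(2) mpow_proper[OF assms] by blast
  qed
  then show "radical R (mpow l) \<subseteq> \<mm>" by (auto simp: radical_def)
qed

end

lemma (in local_ring_depth_two) strong_Rees_mpow: "l \<ge> 1 \<Longrightarrow> strong_Rees R \<mm> (mpow l)"
  unfolding strong_Rees_def using primary_mpow radical_mpow num_gens_less by blast

section \<open>Homomorphisms on an ideal that contains a regular pair\<close>

lemma (in cring) nonzerodivisor_QuotD:
  assumes I: "ideal I R" and nz: "nonzerodivisor (R Quot I) (I +> x)"
    and x: "x \<in> carrier R" and w: "w \<in> carrier R" and xw: "x \<otimes> w \<in> I"
  shows "w \<in> I"
proof -
  interpret I: ideal I R by fact
  have "I +> w \<in> carrier (R Quot I)" using w by (auto simp: FactRing_simps)
  moreover have "(I +> x) \<otimes>\<^bsub>R Quot I\<^esub> (I +> w) = \<zero>\<^bsub>R Quot I\<^esub>"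
    using I.rcoset_mult_add[OF x w] a_rcos_zero[OF I xw] by (simp add: FactRing_def)
  ultimately have "I +> w = \<zero>\<^bsub>R Quot I\<^esub>" using nz by (simp add: nonzerodivisor_def)
  then show ?thesis using I.rcos_const_imp_mem[OF w] by (simp add: FactRing_def)
qed

lemma (in cring) regular_pair_if_depth_ge_2:
  assumes "depth R I \<ge> 2"
  shows "\<exists>f \<in> I. \<exists>g \<in> I. (\<forall>w \<in> carrier R. f \<otimes> w = \<zero> \<longrightarrow> w = \<zero>) \<and>
    (\<forall>w \<in> carrier R. g \<otimes> w \<in> PIdl f \<longrightarrow> w \<in> PIdl f)"
proof -
  have "\<exists>xs. set xs \<subseteq> I \<and> regular_sequence R xs \<and> length xs \<ge> 2"
  proof (rule ccontr)
    assume "\<not> ?thesis"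
    then have "length xs \<le> 1" if "set xs \<subseteq> I" "regular_sequence R xs" for xs
      using that by (metis Suc_1 not_less_eq_eq One_nat_def)
    then have "depth R I \<le> enat 1"
      unfolding depth_def by (intro Sup_least) auto
    then have "(2 :: enat) \<le> enat 1" using assms by (rule order_trans[rotated])
    then show False by (simp add: numeral_eq_enat)
  qed
  then obtain xs where xs: "set xs \<subseteq> I" "regular_sequence R xs" "length xs \<ge> 2" by blast
  have carr: "set xs \<subseteq> carrier R" using xs(2) by (simp add: regular_sequence_def)
  have nz: "w \<in> Idl (set (take i xs))"
    if "i < length xs" "w \<in> carrier R" "(xs ! i) \<otimes> w \<in> Idl (set (take i xs))" for i w
  proof (rule nonzerodivisor_QuotD)
    show "ideal (Idl (set (take i xs))) R"
      using carr set_take_subset[of i xs] by (intro genideal_ideal) blast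
    show "xs ! i \<in> carrier R" using that(1) carr nth_mem by blast
  qed (use that xs(2) in \<open>auto simp: regular_sequence_def\<close>)
  let ?f = "xs ! 0" and ?g = "xs ! 1"
  have mem: "?f \<in> set xs" "?g \<in> set xs"
    using xs(3) nth_mem[of 0 xs] nth_mem[of 1 xs] by linarith+
  have fc: "?f \<in> carrier R" using mem carr by blast
  have e: "Idl {} = {\<zero>}"
  proof
    show "Idl {} \<subseteq> {\<zero>}" using genideal_minimal[OF zeroideal, of "{}"] by simp
    have "ideal (Idl {}) R" by (rule genideal_ideal) simp
    from additive_subgroup.zero_closed[OF ideal.axioms(1)[OF this]]
    show "{\<zero>} \<subseteq> Idl {}" by simp
  qed
  have t1: "take 1 xs = [?f]" using xs(3) by (cases xs) auto
  have s0: "set (take 0 xs) = {}" and s1: "set (take 1 xs) = {?f}" unfolding t1 by simp_all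
  have l: "0 < length xs" "1 < length xs" using xs(3) by auto
  have "w = \<zero>" if w: "w \<in> carrier R" "?f \<otimes> w = \<zero>" for w
    using nz[OF l(1) w(1)] unfolding s0 e w(2) by blast
  moreover have "w \<in> PIdl ?f" if w: "w \<in> carrier R" "?g \<otimes> w \<in> PIdl ?f" for w
    using nz[OF l(2) w(1)] w(2) unfolding s1 cgenideal_eq_genideal[OF fc] by blast
  moreover have "?f \<in> I" "?g \<in> I" using mem xs(1) by auto
  ultimately show ?thesis by blast
qed

context cring
begin

lemma annihilator_ideal:
  assumes "w \<in> carrier R"
  shows "ideal {p \<in> carrier R. p \<otimes> w = \<zero>} R"
proof -
  have "{p \<in> carrier R. p \<otimes> w = \<zero>} = {p \<in> carrier R. w \<otimes> p \<in> {\<zero>}}"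
    using assms m_comm by auto
  then show ?thesis using colon_ideal[OF zeroideal oneideal assms] by simp
qed

text \<open>If \<open>t a \<otimes> Y b = t b \<otimes> Y a\<close> for all \<open>a\<close> and \<open>b\<close>, then \<open>t a \<mapsto> Y a\<close> behaves like a
  homomorphism on the ideal generated by the \<open>t a\<close>. A value \<open>q\<close> for the argument \<open>p\<close> is
  characterised by \<open>t a \<otimes> q = p \<otimes> Y a\<close>; the arguments that have such a value form an ideal, so
  under these relations a regular pair in the ideal generated by the \<open>t a\<close> has values too.\<close>

lemma hom_extension_ideal:
  assumes t: "\<And>a. a \<in> A \<Longrightarrow> t a \<in> carrier R" and Y: "\<And>a. a \<in> A \<Longrightarrow> Y a \<in> carrier R"
  shows "ideal {p \<in> carrier R. \<exists>q \<in> carrier R. \<forall>a \<in> A. t a \<otimes> q = p \<otimes> Y a} R" (is "ideal ?P R")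
proof -
  have mult: "x \<otimes> p \<in> ?P" if p: "p \<in> ?P" and x: "x \<in> carrier R" for x p
  proof -
    obtain q where q: "q \<in> carrier R" "\<forall>a \<in> A. t a \<otimes> q = p \<otimes> Y a" "p \<in> carrier R" using p by blast
    have "t a \<otimes> (x \<otimes> q) = (x \<otimes> p) \<otimes> Y a" if a: "a \<in> A" for a
    proof -
      have "t a \<otimes> (x \<otimes> q) = x \<otimes> (t a \<otimes> q)" using x q(1) t[OF a] by (simp add: m_lcomm)
      also have "\<dots> = (x \<otimes> p) \<otimes> Y a" using q x Y[OF a] a by (simp add: m_assoc)
      finally show ?thesis .
    qed
    then show ?thesis using x q by (intro CollectI conjI bexI[of _ "x \<otimes> q"]) auto
  qed
  have add: "p \<oplus> p' \<in> ?P" if p: "p \<in> ?P" "p' \<in> ?P" for p p'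
  proof -
    obtain q where q: "q \<in> carrier R" "\<forall>a \<in> A. t a \<otimes> q = p \<otimes> Y a" "p \<in> carrier R" using p by blast
    obtain q' where q': "q' \<in> carrier R" "\<forall>a \<in> A. t a \<otimes> q' = p' \<otimes> Y a" "p' \<in> carrier R" using p by blast
    have "t a \<otimes> (q \<oplus> q') = (p \<oplus> p') \<otimes> Y a" if a: "a \<in> A" for a
      using q q' t[OF a] Y[OF a] a by (simp add: r_distr l_distr)
    then show ?thesis using q q' by (intro CollectI conjI bexI[of _ "q \<oplus> q'"]) auto
  qed
  show ?thesis
  proof (rule idealI)
    show "ring R" by (rule ring_axioms)
    show "subgroup ?P (add_monoid R)"
    proof (rule add.subgroupI)
      have "\<zero> \<in> ?P" using t Y by (intro CollectI conjI bexI[of _ \<zero>]) auto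
      then show "?P \<noteq> {}" by blast
      fix p assume p: "p \<in> ?P"
      then have "\<ominus> p = (\<ominus> \<one>) \<otimes> p" by (auto simp: l_minus)
      then show "\<ominus> p \<in> ?P" using mult[OF p, of "\<ominus> \<one>"] by simp
      fix p' assume "p' \<in> ?P"
      then show "p \<oplus> p' \<in> ?P" using add[OF p] by blast
    qed auto
    fix p x assume p: "p \<in> ?P" and x: "x \<in> carrier R"
    show "x \<otimes> p \<in> ?P" using mult[OF p x] .
    moreover have "p \<otimes> x = x \<otimes> p" using p x m_comm by blast
    ultimately show "p \<otimes> x \<in> ?P" by simp
  qed
qed

lemma zero_if_killed:
  assumes t: "\<And>a. a \<in> A \<Longrightarrow> t a \<in> carrier R"
    and f: "\<And>P. ideal P R \<Longrightarrow> t ` A \<subseteq> P \<Longrightarrow> f \<in> P"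
    and reg: "\<And>w. w \<in> carrier R \<Longrightarrow> f \<otimes> w = \<zero> \<Longrightarrow> w = \<zero>"
    and w: "w \<in> carrier R" "\<And>a. a \<in> A \<Longrightarrow> t a \<otimes> w = \<zero>"
  shows "w = \<zero>"
proof -
  have "t ` A \<subseteq> {p \<in> carrier R. p \<otimes> w = \<zero>}" using t w(2) by auto
  then have "f \<in> {p \<in> carrier R. p \<otimes> w = \<zero>}" by (rule f[OF annihilator_ideal[OF w(1)]])
  then show ?thesis using reg[OF w(1)] by simp
qed

lemma minus_eq_zeroD: "a \<in> carrier R \<Longrightarrow> b \<in> carrier R \<Longrightarrow> a \<ominus> b = \<zero> \<Longrightarrow> a = b"
  by (metis r_right_minus_eq)

text \<open>Let \<open>qf\<close> and \<open>qg\<close> be the values at \<open>f\<close> and \<open>g\<close>. Both \<open>g \<otimes> qf\<close> and \<open>f \<otimes> qg\<close> are multiplied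
  by \<open>t a\<close> to \<open>f \<otimes> g \<otimes> Y a\<close>, so they are equal by \<open>zero_if_killed\<close>. As \<open>g\<close> is regular modulo
  \<open>f\<close>, it follows that \<open>qf = z \<otimes> f\<close>, and cancelling \<open>f\<close> in \<open>f \<otimes> Y a = t a \<otimes> qf\<close> gives the claim.\<close>

lemma regular_pair_hom_is_mult:
  assumes t: "\<And>a. a \<in> A \<Longrightarrow> t a \<in> carrier R" and Y: "\<And>a. a \<in> A \<Longrightarrow> Y a \<in> carrier R"
    and comm: "\<And>a b. a \<in> A \<Longrightarrow> b \<in> A \<Longrightarrow> t a \<otimes> Y b = t b \<otimes> Y a"
    and f: "\<And>P. ideal P R \<Longrightarrow> t ` A \<subseteq> P \<Longrightarrow> f \<in> P"
    and g: "\<And>P. ideal P R \<Longrightarrow> t ` A \<subseteq> P \<Longrightarrow> g \<in> P"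
    and regf: "\<And>w. w \<in> carrier R \<Longrightarrow> f \<otimes> w = \<zero> \<Longrightarrow> w = \<zero>"
    and regg: "\<And>w. w \<in> carrier R \<Longrightarrow> g \<otimes> w \<in> PIdl f \<Longrightarrow> w \<in> PIdl f"
  shows "\<exists>z \<in> carrier R. \<forall>a \<in> A. Y a = t a \<otimes> z"
proof -
  let ?P = "{p \<in> carrier R. \<exists>q \<in> carrier R. \<forall>a \<in> A. t a \<otimes> q = p \<otimes> Y a}"
  have P: "ideal ?P R" by (rule hom_extension_ideal[OF t Y])
  have tP: "t ` A \<subseteq> ?P" using t Y comm by blast
  obtain qf where qf: "qf \<in> carrier R" "\<And>a. a \<in> A \<Longrightarrow> t a \<otimes> qf = f \<otimes> Y a" "f \<in> carrier R"
    using f[OF P tP] by blast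
  obtain qg where qg: "qg \<in> carrier R" "\<And>a. a \<in> A \<Longrightarrow> t a \<otimes> qg = g \<otimes> Y a" "g \<in> carrier R"
    using g[OF P tP] by blast
  have "g \<otimes> qf \<ominus> f \<otimes> qg = \<zero>"
  proof (rule zero_if_killed[where A = A and t = t, OF t f regf])
    fix a assume a: "a \<in> A"
    have "t a \<otimes> (g \<otimes> qf \<ominus> f \<otimes> qg) = g \<otimes> (t a \<otimes> qf) \<ominus> f \<otimes> (t a \<otimes> qg)"
      using qf(1,3) qg(1,3) t[OF a] by algebra
    also have "\<dots> = \<zero>"
      unfolding qf(2)[OF a] qg(2)[OF a] using qf(3) qg(3) Y[OF a] by algebra
    finally show "t a \<otimes> (g \<otimes> qf \<ominus> f \<otimes> qg) = \<zero>" .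
  qed (use qf qg in auto)
  then have "g \<otimes> qf = f \<otimes> qg" 
    using minus_eq_zeroD[OF m_closed[OF qg(3) qf(1)] m_closed[OF qf(3) qg(1)]] by blast
  then have "g \<otimes> qf = qg \<otimes> f" using m_comm[OF qf(3) qg(1)] by simp
  then have "g \<otimes> qf \<in> PIdl f" using qg(1) unfolding cgenideal_def by blast
  then have "qf \<in> PIdl f" using regg[OF qf(1)] by blast
  then obtain z where z: "z \<in> carrier R" "qf = z \<otimes> f" by (auto simp: cgenideal_def)
  have "Y a = t a \<otimes> z" if a: "a \<in> A" for a
  proof -
    have "f \<otimes> (Y a \<ominus> t a \<otimes> z) = f \<otimes> Y a \<ominus> t a \<otimes> (z \<otimes> f)"
      using qf(3) z(1) t[OF a] Y[OF a] by algebra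
    also have "\<dots> = \<zero>"
      unfolding z(2)[symmetric] qf(2)[OF a] using qf(3) Y[OF a] by algebra
    finally have "Y a \<ominus> t a \<otimes> z = \<zero>" 
      using regf[OF minus_closed[OF Y[OF a] m_closed[OF t[OF a] z(1)]]] by blast
    then show ?thesis using minus_eq_zeroD[OF Y[OF a] m_closed[OF t[OF a] z(1)]] by blast
  qed
  then show ?thesis using z(1) by blast
qed

end

section \<open>The associated graded ring as an image of the Rees ring\<close>

context noetherian_local_ring
begin

abbreviation G where "G \<equiv> assoc_graded R \<mm>"

text \<open>The polynomials whose coefficient in degree \<open>n\<close> lies in \<open>\<mm>\<^sup>n\<close> form the Rees ring, a
  subring of the polynomial ring. Taking residue classes of the coefficients maps it onto the
  associated graded ring (\<open>symbol\<close>) and respects the operations; since the product in the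
  associated graded ring is the Cauchy product, this is how the ring axioms are obtained for it
  without manipulating sums of cosets.\<close>

definition rees :: "(nat \<Rightarrow> 'a) set" where
  "rees = {p \<in> carrier (UP R). \<forall>n. p n \<in> mpow n}"

definition symbol :: "(nat \<Rightarrow> 'a) \<Rightarrow> nat \<Rightarrow> 'a set" where
  "symbol p = (\<lambda>n. mpow (Suc n) +> p n)"

lemma UP_cring_R: "UP_cring R"
  by (rule UP_cring.intro) (rule cring_axioms)

lemma UP_coeff: "p \<in> carrier (UP R) \<Longrightarrow> up_ring.coeff (UP R) p n = p n"
  by (simp add: UP_def)

lemma rees_carrier: "p \<in> rees \<Longrightarrow> p \<in> carrier (UP R)"
  by (simp add: rees_def)

lemma rees_mpow: "p \<in> rees \<Longrightarrow> p n \<in> mpow n"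
  by (simp add: rees_def)

lemma UP_add: "p \<in> carrier (UP R) \<Longrightarrow> q \<in> carrier (UP R) \<Longrightarrow> (p \<oplus>\<^bsub>UP R\<^esub> q) n = p n \<oplus> q n"
  by (simp add: UP_def)

lemma UP_mult: "p \<in> carrier (UP R) \<Longrightarrow> q \<in> carrier (UP R) \<Longrightarrow>
    (p \<otimes>\<^bsub>UP R\<^esub> q) n = (\<Oplus>i \<in> {..n}. p i \<otimes> q (n - i))"
  by (simp add: UP_def)

lemma mpow_finsum:
  assumes "\<And>i. i \<in> A \<Longrightarrow> f i \<in> mpow n"
  shows "(\<Oplus>i \<in> A. f i) \<in> mpow n"
  using assms
proof (induction A rule: infinite_finite_induct)
  case (insert x F)
  then have "f x \<in> mpow n" "(\<Oplus>i \<in> F. f i) \<in> mpow n" by auto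
  moreover have "f \<in> F \<rightarrow> carrier R" "f x \<in> carrier R" using insert.prems mpow_carr by auto
  ultimately show ?case
    using insert.hyps additive_subgroup.a_closed[OF ideal.axioms(1)[OF mpow_ideal]] by simp
qed (simp_all add: mpow_zero)

lemma rees_cring: "cring (UP R\<lparr>carrier := rees\<rparr>)"
proof -
  interpret U: UP_cring R "UP R" by (rule UP_cring_R)
  have "subring rees (UP R)"
  proof (rule U.P.subringI)
    show "rees \<subseteq> carrier (UP R)" using rees_carrier by blast
    show "\<one>\<^bsub>UP R\<^esub> \<in> rees"
    proof -
      have "\<one>\<^bsub>UP R\<^esub> n \<in> mpow n" for n
        by (cases n) (simp_all add: UP_def mpow_0 mpow_zero)
      then show ?thesis using U.P.one_closed by (simp add: rees_def)
    qed
  next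
    fix p assume p: "p \<in> rees"
    have "(\<ominus>\<^bsub>UP R\<^esub> p) n = \<ominus> (p n)" for n
      using U.coeff_a_inv[OF rees_carrier[OF p], of n] UP_coeff rees_carrier[OF p] by simp
    moreover have "\<ominus> (p n) \<in> mpow n" for n
      using additive_subgroup.a_inv_closed[OF ideal.axioms(1)[OF mpow_ideal] rees_mpow[OF p]] .
    ultimately show "\<ominus>\<^bsub>UP R\<^esub> p \<in> rees" using rees_carrier[OF p] by (simp add: rees_def)
    fix q assume q: "q \<in> rees"
    show "p \<oplus>\<^bsub>UP R\<^esub> q \<in> rees"
      using p q UP_add U.P.a_closed additive_subgroup.a_closed[OF ideal.axioms(1)[OF mpow_ideal]]
      by (simp add: rees_def)
    have "p i \<otimes> q (n - i) \<in> mpow n" if "i \<le> n" for i n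
      using mpow_mult[OF rees_mpow[OF p, of i] rees_mpow[OF q, of "n - i"]] that by simp
    then have "(p \<otimes>\<^bsub>UP R\<^esub> q) n \<in> mpow n" for n
      unfolding UP_mult[OF rees_carrier[OF p] rees_carrier[OF q]] by (intro mpow_finsum) simp
    then show "p \<otimes>\<^bsub>UP R\<^esub> q \<in> rees" using rees_carrier p q by (simp add: rees_def)
  qed
  then show ?thesis
    using U.P.subcring_iff[of rees] U.P.subcringI' rees_carrier by blast
qed

lemma coset_eq_mpow: "x \<in> mpow n \<Longrightarrow> mpow n +> x = mpow n"
  using a_rcos_zero[OF mpow_ideal] .

lemma coset_eq_mpow_iff: "x \<in> carrier R \<Longrightarrow> mpow n +> x = mpow n \<longleftrightarrow> x \<in> mpow n"
  using coset_eq_mpow ideal.rcos_const_imp_mem[OF mpow_ideal] by blast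

lemma G_zero: "\<zero>\<^bsub>G\<^esub> = (\<lambda>n. mpow (Suc n))"
  by (simp add: assoc_graded_def mpow_def)

lemma symbol_closed:
  assumes p: "p \<in> rees" shows "symbol p \<in> carrier G"
proof -
  obtain N where N: "bound \<zero> N p" using rees_carrier[OF p] by (auto simp: UP_def up_def)
  have "{n. symbol p n \<noteq> mpow (Suc n)} \<subseteq> {..N}"
  proof
    fix n assume n: "n \<in> {n. symbol p n \<noteq> mpow (Suc n)}"
    have "p n \<noteq> \<zero>" using n coset_eq_mpow[OF mpow_zero] by (auto simp: symbol_def)
    then show "n \<in> {..N}" using bound_below[OF N] by auto
  qed
  then have "finite {n. symbol p n \<noteq> mpow (Suc n)}" using finite_subset by blast
  moreover have "symbol p n \<in> graded_piece R \<mm> n" for n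
    using rees_mpow[OF p, of n] unfolding graded_piece_def symbol_def mpow_def by blast
  ultimately show ?thesis unfolding assoc_graded_def mpow_def[symmetric] by simp
qed

lemma symbol_surj:
  assumes f: "f \<in> carrier G"
  obtains p where "p \<in> rees" "f = symbol p"
proof -
  have "\<forall>n. \<exists>x. x \<in> mpow n \<and> f n = mpow (Suc n) +> x \<and> (f n = mpow (Suc n) \<longrightarrow> x = \<zero>)"
  proof
    fix n
    have "f n \<in> graded_piece R \<mm> n" using f by (simp add: assoc_graded_def)
    then obtain x where x: "x \<in> mpow n" "f n = mpow (Suc n) +> x"
      unfolding graded_piece_def mpow_def by blast
    show "\<exists>x. x \<in> mpow n \<and> f n = mpow (Suc n) +> x \<and> (f n = mpow (Suc n) \<longrightarrow> x = \<zero>)"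
    proof (cases "f n = mpow (Suc n)")
      case True
      then show ?thesis using coset_eq_mpow[OF mpow_zero] mpow_zero by auto
    next
      case False
      then show ?thesis using x by blast
    qed
  qed
  then obtain p where p: "\<And>n. p n \<in> mpow n" "\<And>n. f n = mpow (Suc n) +> p n"
    "\<And>n. f n = mpow (Suc n) \<Longrightarrow> p n = \<zero>" by metis
  have "finite {n. f n \<noteq> mpow (Suc n)}" using f by (simp add: assoc_graded_def mpow_def)
  then obtain N where N: "\<And>n. f n \<noteq> mpow (Suc n) \<Longrightarrow> n \<le> N"
    unfolding finite_nat_set_iff_bounded_le by blast
  have "bound \<zero> N p"
  proof
    fix m assume "N < m"
    then show "p m = \<zero>" using N[of m] p(3)[of m] by auto
  qed
  then have "p \<in> rees" using p(1) mpow_carr by (auto simp: rees_def UP_def up_def)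
  moreover have "f = symbol p" using p(2) by (auto simp: symbol_def)
  ultimately show ?thesis by (rule that)
qed

lemma symbol_add:
  assumes p: "p \<in> rees" and q: "q \<in> rees"
  shows "symbol (p \<oplus>\<^bsub>UP R\<^esub> q) = symbol p \<oplus>\<^bsub>G\<^esub> symbol q"
proof
  fix n
  show "symbol (p \<oplus>\<^bsub>UP R\<^esub> q) n = (symbol p \<oplus>\<^bsub>G\<^esub> symbol q) n"
    using ideal.a_rcos_sum[OF mpow_ideal, of "p n" "q n" "Suc n"] UP_add[OF rees_carrier[OF p] rees_carrier[OF q]]
      mpow_carr[OF rees_mpow[OF p, of n]] mpow_carr[OF rees_mpow[OF q, of n]]
    by (simp add: symbol_def assoc_graded_def)
qed

lemma symbol_mult:
  assumes p: "p \<in> rees" and q: "q \<in> rees"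
  shows "symbol (p \<otimes>\<^bsub>UP R\<^esub> q) = symbol p \<otimes>\<^bsub>G\<^esub> symbol q"
proof
  fix n
  let ?K = "mpow (Suc n)"
  have pc: "p i \<in> carrier R" "q i \<in> carrier R" for i
    using rees_mpow[OF p, of i] rees_mpow[OF q, of i] mpow_carr by auto
  interpret h: ring_hom_cring R "R Quot ?K" "(+>) ?K"
    by (rule ideal.rcos_ring_hom_cring[OF mpow_ideal cring_axioms])
  have "symbol (p \<otimes>\<^bsub>UP R\<^esub> q) n = ?K +> (\<Oplus>i \<in> {..n}. p i \<otimes> q (n - i))"
    using UP_mult[OF rees_carrier[OF p] rees_carrier[OF q]] by (simp add: symbol_def)
  also have "\<dots> = (\<Oplus>\<^bsub>R Quot ?K\<^esub> i \<in> {..n}. ((+>) ?K \<circ> (\<lambda>i. p i \<otimes> q (n - i))) i)"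
    by (rule h.hom_finsum) (use pc in auto)
  also have "\<dots> = (\<Oplus>\<^bsub>R Quot ?K\<^esub> i \<in> {..n}. rcoset_mult R ?K (symbol p i) (symbol q (n - i)))"
  proof (rule h.S.finsum_cong')
    show "(\<lambda>i. rcoset_mult R ?K (symbol p i) (symbol q (n - i))) \<in> {..n} \<rightarrow> carrier (R Quot ?K)"
    proof
      fix i assume "i \<in> {..n}"
      then have "rcoset_mult R ?K (symbol p i) (symbol q (n - i)) = ?K +> (p i \<otimes> q (n - i))"
        using rcoset_mult_graded_piece[OF ideal_mm, of "p i" i "q (n - i)" "n - i"]
          rees_mpow[OF p, of i] rees_mpow[OF q, of "n - i"]
        unfolding symbol_def mpow_def by simp
      then show "rcoset_mult R ?K (symbol p i) (symbol q (n - i)) \<in> carrier (R Quot ?K)"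
        using h.hom_closed pc by simp
    qed
    fix i assume "i \<in> {..n}"
    then show "((+>) ?K \<circ> (\<lambda>i. p i \<otimes> q (n - i))) i = rcoset_mult R ?K (symbol p i) (symbol q (n - i))"
      using rcoset_mult_graded_piece[OF ideal_mm, of "p i" i "q (n - i)" "n - i"]
        rees_mpow[OF p, of i] rees_mpow[OF q, of "n - i"]
      unfolding symbol_def mpow_def by simp
  qed simp
  also have "\<dots> = (symbol p \<otimes>\<^bsub>G\<^esub> symbol q) n"
    by (simp add: assoc_graded_def mpow_def)
  finally show "symbol (p \<otimes>\<^bsub>UP R\<^esub> q) n = (symbol p \<otimes>\<^bsub>G\<^esub> symbol q) n" .
qed

lemma symbol_one: "symbol \<one>\<^bsub>UP R\<^esub> = \<one>\<^bsub>G\<^esub>"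
proof
  fix n show "symbol \<one>\<^bsub>UP R\<^esub> n = \<one>\<^bsub>G\<^esub> n"
    using coset_eq_mpow[OF mpow_zero, of "Suc n"]
    by (simp add: symbol_def assoc_graded_def UP_def mpow_def)
qed

lemma symbol_eq_zero_iff:
  assumes "p \<in> rees"
  shows "symbol p = \<zero>\<^bsub>G\<^esub> \<longleftrightarrow> (\<forall>n. p n \<in> mpow (Suc n))"
  using coset_eq_mpow_iff mpow_carr[OF rees_mpow[OF assms]] by (simp add: symbol_def G_zero fun_eq_iff)

lemma assoc_graded_cring: "cring G"
proof -
  let ?S = "UP R\<lparr>carrier := rees\<rparr>"
  interpret S: cring ?S by (rule rees_cring)
  have hom: "symbol \<in> ring_hom ?S G"
    by (rule ring_hom_memI) (simp_all add: symbol_closed symbol_add symbol_mult symbol_one)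
  have "symbol ` rees = carrier G" using symbol_closed symbol_surj by blast
  moreover have "symbol \<zero>\<^bsub>UP R\<^esub> = \<zero>\<^bsub>G\<^esub>"
    using symbol_eq_zero_iff[of "\<zero>\<^bsub>UP R\<^esub>"] S.zero_closed mpow_zero by (simp add: UP_def)
  ultimately have "ring (G\<lparr>carrier := carrier G, zero := \<zero>\<^bsub>G\<^esub>\<rparr>)"
    using S.ring_hom_imp_img_ring[OF hom] by simp
  then interpret G: ring G by simp
  show ?thesis
  proof (unfold_locales)
    fix x y assume "x \<in> carrier G" "y \<in> carrier G"
    then obtain p q where pq: "p \<in> rees" "x = symbol p" "q \<in> rees" "y = symbol q"
      using symbol_surj by metis
    moreover have "p \<otimes>\<^bsub>UP R\<^esub> q = q \<otimes>\<^bsub>UP R\<^esub> p" using S.m_comm[of p q] pq(1,3) by simp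
    ultimately show "x \<otimes>\<^bsub>G\<^esub> y = y \<otimes>\<^bsub>G\<^esub> x" by (metis symbol_mult)
  qed
qed

definition initial_form :: "nat \<Rightarrow> 'a \<Rightarrow> nat \<Rightarrow> 'a set" where
  "initial_form n a = symbol (up_ring.monom (UP R) a n)"

lemma monom_apply: "a \<in> carrier R \<Longrightarrow> up_ring.monom (UP R) a n k = (if k = n then a else \<zero>)"
  by (simp add: UP_def)

lemma monom_rees:
  assumes a: "a \<in> mpow n" shows "up_ring.monom (UP R) a n \<in> rees"
proof -
  interpret U: UP_cring R "UP R" by (rule UP_cring_R)
  show ?thesis using a mpow_carr[OF a] mpow_zero by (auto simp: rees_def monom_apply)
qed

lemma initial_form_closed: "a \<in> mpow n \<Longrightarrow> initial_form n a \<in> carrier G"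
  unfolding initial_form_def by (intro symbol_closed monom_rees)

lemma initial_form_mult:
  assumes a: "a \<in> mpow n" and b: "b \<in> mpow k"
  shows "initial_form n a \<otimes>\<^bsub>G\<^esub> initial_form k b = initial_form (n + k) (a \<otimes> b)"
proof -
  interpret U: UP_cring R "UP R" by (rule UP_cring_R)
  show ?thesis unfolding initial_form_def
    using symbol_mult[OF monom_rees[OF a] monom_rees[OF b]] U.monom_mult mpow_carr[OF a] mpow_carr[OF b] by simp
qed

lemma initial_form_add:
  assumes a: "a \<in> mpow n" and b: "b \<in> mpow n"
  shows "initial_form n (a \<oplus> b) = initial_form n a \<oplus>\<^bsub>G\<^esub> initial_form n b"
proof -
  interpret U: UP_cring R "UP R" by (rule UP_cring_R)
  show ?thesis unfolding initial_form_def
    using symbol_add[OF monom_rees[OF a] monom_rees[OF b]] U.monom_add mpow_carr[OF a] mpow_carr[OF b] by simp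
qed

lemma initial_form_apply: "a \<in> carrier R \<Longrightarrow> initial_form n a k = (if k = n then mpow (Suc n) +> a else mpow (Suc k))"
  using coset_eq_mpow[OF mpow_zero] by (simp add: initial_form_def symbol_def monom_apply)

lemma initial_form_eqI:
  assumes "a \<in> mpow n" "b \<in> mpow n" "a \<ominus> b \<in> mpow (Suc n)"
  shows "initial_form n a = initial_form n b"
proof
  fix k
  have "mpow (Suc n) +> a = mpow (Suc n) +> b"
    using quotient_eq_iff_same_a_r_cos[OF mpow_ideal] assms mpow_carr by blast
  then show "initial_form n a k = initial_form n b k" using initial_form_apply assms mpow_carr by simp
qed

lemma initial_form_eq_zero_iff:
  assumes "a \<in> mpow n" shows "initial_form n a = \<zero>\<^bsub>G\<^esub> \<longleftrightarrow> a \<in> mpow (Suc n)"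
  using coset_eq_mpow_iff[OF mpow_carr[OF assms]] initial_form_apply[OF mpow_carr[OF assms]]
  by (auto simp: G_zero fun_eq_iff)

lemma initial_form_mult_symbol:
  assumes a: "a \<in> \<mm>" and p: "p \<in> rees"
  shows "(initial_form (Suc 0) a \<otimes>\<^bsub>G\<^esub> symbol p) 0 = mpow (Suc 0)"
    and "(initial_form (Suc 0) a \<otimes>\<^bsub>G\<^esub> symbol p) (Suc k) = mpow (Suc (Suc k)) +> (a \<otimes> p k)"
proof -
  interpret U: UP_cring R "UP R" by (rule UP_cring_R)
  have a1: "a \<in> mpow (Suc 0)" and ac: "a \<in> carrier R" using a mpow_1 mm_carr by auto
  let ?m = "up_ring.monom (UP R) a (Suc 0)"
  have eq: "initial_form (Suc 0) a \<otimes>\<^bsub>G\<^esub> symbol p = symbol (?m \<otimes>\<^bsub>UP R\<^esub> p)"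
    unfolding initial_form_def using symbol_mult[OF monom_rees[OF a1] p] by simp
  have "(?m \<otimes>\<^bsub>UP R\<^esub> p) 0 = \<zero>"
    using UP_mult[OF rees_carrier[OF monom_rees[OF a1]] rees_carrier[OF p], of 0] ac
      mpow_carr[OF rees_mpow[OF p, of 0]] by (simp add: monom_apply)
  then show "(initial_form (Suc 0) a \<otimes>\<^bsub>G\<^esub> symbol p) 0 = mpow (Suc 0)"
    unfolding eq using coset_eq_mpow[OF mpow_zero] by (simp add: symbol_def)
  have "(?m \<otimes>\<^bsub>UP R\<^esub> p) (Suc k) = a \<otimes> p k"
    using U.coeff_monom_mult[OF ac rees_carrier[OF p], of "Suc 0" k]
      UP_coeff[OF U.P.m_closed[OF rees_carrier[OF monom_rees[OF a1]] rees_carrier[OF p]]]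
      UP_coeff[OF rees_carrier[OF p]] by simp
  then show "(initial_form (Suc 0) a \<otimes>\<^bsub>G\<^esub> symbol p) (Suc k) = mpow (Suc (Suc k)) +> (a \<otimes> p k)"
    unfolding eq by (simp add: symbol_def)
qed

text \<open>An element of \<open>\<mm>\<^sup>k\<^sup>+\<^sup>1\<close> is a sum of products of elements of \<open>\<mm>\<close> and of \<open>\<mm>\<^sup>k\<close>, so initial
  forms of positive degree are generated by those of degree one.\<close>

lemma initial_form_in_ideal:
  assumes P: "ideal P G" and deg1: "initial_form (Suc 0) ` \<mm> \<subseteq> P" and c: "c \<in> mpow (Suc k)"
  shows "initial_form (Suc k) c \<in> P"
proof -
  interpret P: ideal P G by (rule P)
  have "c \<in> ideal_prod R \<mm> (mpow k)" using c mpow_Suc by simp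
  then have "c \<in> mpow (Suc k) \<and> initial_form (Suc k) c \<in> P"
  proof (induction rule: ideal_prod.induct)
    case (prod a b)
    have "initial_form (Suc 0) a \<otimes>\<^bsub>G\<^esub> initial_form k b \<in> P"
      using P.I_r_closed[of "initial_form (Suc 0) a" "initial_form k b"] deg1 prod initial_form_closed by blast
    then show ?case
      using initial_form_mult[of a "Suc 0" b k] prod mpow_1 mm_mult by simp
  next
    case (sum x y)
    then show ?case using initial_form_add[of x "Suc k" y] additive_subgroup.a_closed[OF ideal.axioms(1)[OF mpow_ideal]] P.a_closed by simp
  qed
  then show ?thesis by blast
qed

text \<open>Splitting off the top coefficient of a representing polynomial writes an element as a sum
  of initial forms.\<close>

lemma irrelevant_ideal_subset:
  assumes P: "ideal P G" and deg1: "initial_form (Suc 0) ` \<mm> \<subseteq> P"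
  shows "irrelevant_ideal R \<mm> \<subseteq> P"
proof
  interpret P: ideal P G by (rule P)
  interpret U: UP_cring R "UP R" by (rule UP_cring_R)
  fix f assume f: "f \<in> irrelevant_ideal R \<mm>"
  then obtain p where p: "p \<in> rees" "f = symbol p"
    using symbol_surj by (auto simp: irrelevant_ideal_def)
  have "f 0 = mpow (Suc 0)" using f G_zero by (simp add: irrelevant_ideal_def)
  then have p0: "p 0 \<in> mpow (Suc 0)"
    using coset_eq_mpow_iff[OF mpow_carr[OF rees_mpow[OF p(1), of 0]], of "Suc 0"] p(2)
    by (simp add: symbol_def)
  have "symbol q \<in> P" if "q \<in> rees" "q 0 \<in> mpow (Suc 0)" "\<And>n. n \<ge> N \<Longrightarrow> q n = \<zero>" for q N
    using that
  proof (induction N arbitrary: q)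
    case 0
    have "q n \<in> mpow (Suc n)" for n using "0.prems"(3)[of n] mpow_zero by simp
    then have "symbol q = \<zero>\<^bsub>G\<^esub>" using symbol_eq_zero_iff[OF "0.prems"(1)] by blast
    then show ?case by simp
  next
    case (Suc N)
    let ?r = "q(N := \<zero>)" and ?m = "up_ring.monom (UP R) (q N) N"
    have qN: "q N \<in> mpow N" using rees_mpow[OF Suc.prems(1)] .
    have up: "?r \<in> up R"
    proof (rule mem_upI)
      show "?r n \<in> carrier R" for n using mpow_carr[OF rees_mpow[OF Suc.prems(1), of n]] by simp
      have "bound \<zero> N ?r"
      proof (rule bound.intro)
        fix m assume "N < m"
        then show "?r m = \<zero>" using Suc.prems(3)[of m] by simp
      qed
      then show "\<exists>n. bound \<zero> n ?r" by (rule exI)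
    qed
    have r: "?r \<in> rees"
      unfolding rees_def
    proof (intro CollectI conjI allI)
      show "?r \<in> carrier (UP R)" using up unfolding UP_def by (simp only: partial_object.select_convs)
      show "?r n \<in> mpow n" for n using rees_mpow[OF Suc.prems(1), of n] mpow_zero by simp
    qed
    have rP: "symbol ?r \<in> P"
    proof (rule Suc.IH[OF r])
      show "?r 0 \<in> mpow (Suc 0)" using Suc.prems(2) mpow_zero by simp
      fix n assume "n \<ge> N"
      then show "?r n = \<zero>" using Suc.prems(3)[of n] by (cases "n = N") simp_all
    qed
    have mP: "initial_form N (q N) \<in> P"
    proof (cases N)
      case 0
      then have "initial_form N (q N) = \<zero>\<^bsub>G\<^esub>" using initial_form_eq_zero_iff[OF qN] Suc.prems(2) by simp
      then show ?thesis by simp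
    next
      case (Suc k)
      then show ?thesis using initial_form_in_ideal[OF P deg1, of "q N" k] qN by simp
    qed
    have eq: "?r \<oplus>\<^bsub>UP R\<^esub> ?m = q"
    proof
      fix n
      show "(?r \<oplus>\<^bsub>UP R\<^esub> ?m) n = q n"
        using UP_add[OF rees_carrier[OF r] rees_carrier[OF monom_rees[OF qN]], of n]
          monom_apply[OF mpow_carr[OF qN]] mpow_carr[OF rees_mpow[OF Suc.prems(1), of n]]
          mpow_carr[OF qN] by simp
    qed
    have "symbol q = symbol ?r \<oplus>\<^bsub>G\<^esub> initial_form N (q N)"
      using symbol_add[OF r monom_rees[OF qN]] unfolding eq initial_form_def .
    then show ?case using additive_subgroup.a_closed[OF ideal.axioms(1)[OF P] rP mP] by (simp only:)
  qed
  note claim = this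
  obtain N where N: "bound \<zero> N p" using rees_carrier[OF p(1)] by (auto simp: UP_def up_def)
  have "p n = \<zero>" if "n \<ge> Suc N" for n using bound.bound[OF N] that by simp
  then show "f \<in> P" unfolding p(2) by (rule claim[OF p(1) p0])
qed

text \<open>The initial forms of degree one generate an ideal that contains a regular pair, so the
  results on such ideals apply to the initial forms of the \<open>y a\<close>. The multiplier \<open>z\<close> found there
  may be inhomogeneous; comparing components of the degree of \<open>y a\<close> leaves one coefficient of a
  polynomial that represents \<open>z\<close>, and none if \<open>y a\<close> has degree \<open>0\<close>.\<close>

lemma local_ring_depth_two_if_depth_ge_2:
  assumes "depth G (irrelevant_ideal R \<mm>) \<ge> 2"
  shows "local_ring_depth_two R \<mm>"
proof -
  interpret G: cring G by (rule assoc_graded_cring)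
  obtain f g where irr: "f \<in> irrelevant_ideal R \<mm>" "g \<in> irrelevant_ideal R \<mm>"
    and regf: "\<And>w. w \<in> carrier G \<Longrightarrow> f \<otimes>\<^bsub>G\<^esub> w = \<zero>\<^bsub>G\<^esub> \<Longrightarrow> w = \<zero>\<^bsub>G\<^esub>"
    and regg: "\<And>w. w \<in> carrier G \<Longrightarrow> g \<otimes>\<^bsub>G\<^esub> w \<in> PIdl\<^bsub>G\<^esub> f \<Longrightarrow> w \<in> PIdl\<^bsub>G\<^esub> f"
    using G.regular_pair_if_depth_ge_2[OF assms] by blast
  let ?t = "initial_form (Suc 0)"
  have m1: "a \<in> mpow (Suc 0)" if "a \<in> \<mm>" for a using that mpow_1 by simp
  have tc: "?t a \<in> carrier G" if "a \<in> \<mm>" for a using initial_form_closed[OF m1[OF that]] .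
  have fP: "f \<in> P" and gP: "g \<in> P" if "ideal P G" "?t ` \<mm> \<subseteq> P" for P
    using irrelevant_ideal_subset[OF that] irr by auto
  have hom: "\<exists>z \<in> carrier G. \<forall>a \<in> \<mm>. initial_form n (y a) = ?t a \<otimes>\<^bsub>G\<^esub> z"
    if y: "\<And>a. a \<in> \<mm> \<Longrightarrow> y a \<in> mpow n"
      "\<And>a b. a \<in> \<mm> \<Longrightarrow> b \<in> \<mm> \<Longrightarrow> a \<otimes> y b \<ominus> b \<otimes> y a \<in> mpow (Suc (Suc n))" for y n
  proof (rule G.regular_pair_hom_is_mult[OF tc _ _ fP gP regf regg])
    fix a b assume ab: "a \<in> \<mm>" "b \<in> \<mm>"
    show "initial_form n (y a) \<in> carrier G" using initial_form_closed y(1) ab by blast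
    show "?t a \<otimes>\<^bsub>G\<^esub> initial_form n (y b) = ?t b \<otimes>\<^bsub>G\<^esub> initial_form n (y a)"
      using initial_form_mult[OF m1 y(1)] ab initial_form_eqI[of "a \<otimes> y b" "Suc n" "b \<otimes> y a"]
        y(2)[OF ab] mm_mult[OF ab(1) y(1)[OF ab(2)]] mm_mult[OF ab(2) y(1)[OF ab(1)]] by simp
  qed
  show ?thesis
  proof (unfold_locales)
    fix c n assume c: "c \<in> mpow n" "\<And>a. a \<in> \<mm> \<Longrightarrow> a \<otimes> c \<in> mpow (n + 2)"
    have "initial_form n c = \<zero>\<^bsub>G\<^esub>"
    proof (rule G.zero_if_killed[OF tc fP regf initial_form_closed[OF c(1)]])
      fix a assume a: "a \<in> \<mm>"
      have "initial_form (Suc n) (a \<otimes> c) = \<zero>\<^bsub>G\<^esub>"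
        using initial_form_eq_zero_iff[OF mm_mult[OF a c(1)]] c(2)[OF a] by simp
      then show "?t a \<otimes>\<^bsub>G\<^esub> initial_form n c = \<zero>\<^bsub>G\<^esub>" using initial_form_mult[OF m1[OF a] c(1)] by simp
    qed
    then show "c \<in> mpow (n + 1)" using initial_form_eq_zero_iff[OF c(1)] by simp
  next
    fix y n
    assume y: "\<And>a. a \<in> \<mm> \<Longrightarrow> y a \<in> mpow (n + 1)"
      "\<And>a b. a \<in> \<mm> \<Longrightarrow> b \<in> \<mm> \<Longrightarrow> a \<otimes> y b \<ominus> b \<otimes> y a \<in> mpow (n + 3)"
    then obtain z where z: "z \<in> carrier G" "\<And>a. a \<in> \<mm> \<Longrightarrow> initial_form (Suc n) (y a) = ?t a \<otimes>\<^bsub>G\<^esub> z"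
      using hom[of y "Suc n"] by (auto simp: numeral_3_eq_3)
    obtain p where p: "p \<in> rees" "z = symbol p" using symbol_surj[OF z(1)] .
    have "y a \<ominus> a \<otimes> p n \<in> mpow (n + 2)" if a: "a \<in> \<mm>" for a
    proof -
      have "y a \<in> carrier R" "a \<otimes> p n \<in> carrier R"
        using mpow_carr[OF y(1)[OF a]] mm_carr[OF a] mpow_carr[OF rees_mpow[OF p(1)]] by auto
      moreover have "mpow (Suc (Suc n)) +> y a = mpow (Suc (Suc n)) +> (a \<otimes> p n)"
        using fun_cong[OF z(2)[OF a], of "Suc n"] initial_form_mult_symbol(2)[OF a p(1)] p(2)
          initial_form_apply[OF mpow_carr[OF y(1)[OF a]]] by simp
      ultimately show ?thesis using quotient_eq_iff_same_a_r_cos[OF mpow_ideal] by simp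
    qed
    then show "\<exists>z \<in> mpow n. \<forall>a \<in> \<mm>. y a \<ominus> a \<otimes> z \<in> mpow (n + 2)"
      using rees_mpow[OF p(1)] by blast
  next
    fix y a
    assume y: "\<And>a. a \<in> \<mm> \<Longrightarrow> y a \<in> carrier R"
      "\<And>a b. a \<in> \<mm> \<Longrightarrow> b \<in> \<mm> \<Longrightarrow> a \<otimes> y b \<ominus> b \<otimes> y a \<in> mpow 2" and a: "a \<in> \<mm>"
    obtain z where z: "z \<in> carrier G" "\<And>a. a \<in> \<mm> \<Longrightarrow> initial_form 0 (y a) = ?t a \<otimes>\<^bsub>G\<^esub> z"
      using hom[of y 0] y mpow_0 by (auto simp: numeral_2_eq_2)
    obtain p where p: "p \<in> rees" "z = symbol p" using symbol_surj[OF z(1)] .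
    have "mpow (Suc 0) +> y a = mpow (Suc 0)"
      using fun_cong[OF z(2)[OF a], of 0] initial_form_mult_symbol(1)[OF a p(1)] p(2) initial_form_apply[OF y(1)[OF a]] by simp
    then show "y a \<in> \<mm>" using coset_eq_mpow_iff[OF y(1)[OF a], of "Suc 0"] unfolding mpow_1 by blast
  qed
qed

end

theorem corollary3p5:
  fixes A :: "('a, 'b) ring_scheme" and \<mm> :: "'a set" and l :: nat
  assumes "noetherian_local_ring A \<mm>"
    and "depth (assoc_graded A \<mm>) (irrelevant_ideal A \<mm>) \<ge> 2"
    and "l \<ge> 1"
  shows "strong_Rees A \<mm> (ideal_pow A \<mm> l)"
proof -
  interpret noetherian_local_ring A \<mm> by fact
  interpret local_ring_depth_two A \<mm> by (rule local_ring_depth_two_if_depth_ge_2) fact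
  show ?thesis using strong_Rees_mpow[OF assms(3)] by (simp only: mpow_def)
qed

end
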